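(* Let $(E,\tau,M,\rho)$ be a Lie algebroid on a smooth manifold $M$. For each smooth section $V\in A^1(M,E)$ of $(E,\tau,M)$, there exists a unique graded ($\mathbb R$-linear) endomorphism of degree $0$ of the graded algebra of exterior forms $\Omega(M,E)$, called the Lie derivative with respect to $V$ and denoted by $\mathcal L_\rho(V)$, which satisfies: (i) for a smooth function $f\in\Omega^0(M,E)=C^\infty(M,\mathbb R)$, $\mathcal L_\rho(V)f=i(\rho\circ V)df=\mathcal L(\rho\circ V)f$, where $\mathcal L(\rho\circ V)$ is the usual Lie derivative with respect to the vector field $\rho\circ V$; (ii) for a form $\eta\in\Omega^p(M,E)$ of degree $p>0$, $\mathcal L_\rho(V)\eta$ is the form defined by the formula, where $V_1,\dots,V_p$ are smooth sections of $(E,\tau,M)$, $$\bigl(\mathcal L_\rho(V)\eta\bigr)(V_1,\dots,V_p)=\mathcal L_\rho(V)\bigl(\eta(V_1,\dots,V_p)\bigr)-\sum_{i=1}^p\eta(V_1,\dots,V_{i-1},\{V,V_i\},V_{i+1},\dots,V_p).$$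
   Context: A Lie algebroid $(E,\tau,M,\rho)$ is a smooth real vector bundle $\tau:E\to M$ of finite rank over a smooth manifold, with a real Lie algebra bracket $\{\ ,\ \}$ on its smooth sections and a smooth vector bundle map $\rho:E\to TM$ over $\mathrm{id}_M$ (anchor) such that $\{s_1,fs_2\}=f\{s_1,s_2\}+(\mathcal L(\rho\circ s_1)f)s_2$. $A^1(M,E)$ is the space of smooth sections of $E$. $\Omega^p(M,E)$ is the space of smooth sections of $\bigwedge^pE^*$ ($C^\infty(M,\mathbb R)$ for $p=0$, $\{0\}$ for $p<0$), identified with alternating $C^\infty(M,\mathbb R)$-multilinear maps $A^1(M,E)^p\to C^\infty(M,\mathbb R)$; $\Omega(M,E)=\bigoplus_p\Omega^p(M,E)$. "Graded endomorphism of degree $0$" means a linear map of the graded vector space preserving degrees. *)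

theory Defs
  imports "HOL-Analysis.Analysis"
begin

section \<open>Smooth maps between normed spaces\<close>

text \<open>The argument \<^term>\<open>S\<close> is meant to be open and the domain space finite-dimensional; then it is
  enough to ask for regularity of all directional derivatives.\<close>

primrec C_k_on :: "nat \<Rightarrow> ('a::real_normed_vector \<Rightarrow> 'b::real_normed_vector) \<Rightarrow> 'a set \<Rightarrow> bool" where
  "C_k_on 0 f S = continuous_on S f"
| "C_k_on (Suc k) f S =
     (\<exists>f'. (\<forall>x\<in>S. (f has_derivative f' x) (at x)) \<and> (\<forall>v. C_k_on k (\<lambda>x. f' x v) S))"

definition smooth_on :: "('a::real_normed_vector \<Rightarrow> 'b::real_normed_vector) \<Rightarrow> 'a set \<Rightarrow> bool" where
  "smooth_on f S \<longleftrightarrow> (\<forall>k. C_k_on k f S)"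

text \<open>Model spaces are finite-dimensional normed spaces rather than types of class
  \<^class>\<open>euclidean_space\<close>, because the latter have positive dimension: manifolds of dimension
  \<open>0\<close> and bundles of rank \<open>0\<close> are to be included.\<close>

definition finite_dimensional :: "'a::real_vector itself \<Rightarrow> bool" where
  "finite_dimensional _ \<longleftrightarrow> (\<exists>B::'a set. finite B \<and> span B = UNIV)"


section \<open>Manifolds\<close>

text \<open>A chart is given by its domain and its coordinate map; the values of the coordinate map outside
  the domain are irrelevant.\<close>

type_synonym ('m, 'c) chart = "'m set \<times> ('m \<Rightarrow> 'c)"

definition chart_inv :: "('m, 'c) chart \<Rightarrow> 'c \<Rightarrow> 'm" where
  "chart_inv c = inv_into (fst c) (snd c)"

definition smooth_atlas :: "('m, 'c::real_normed_vector) chart set \<Rightarrow> bool" where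
  "smooth_atlas A \<longleftrightarrow>
     (\<Union>c\<in>A. fst c) = UNIV \<and>
     (\<forall>c\<in>A. inj_on (snd c) (fst c)) \<and>
     (\<forall>c\<in>A. \<forall>d\<in>A. open (snd c ` (fst c \<inter> fst d)) \<and>
        smooth_on (snd d \<circ> chart_inv c) (snd c ` (fst c \<inter> fst d)))"

definition smooth_manifold ::
    "('m::{t2_space,second_countable_topology}, 'c::real_normed_vector) chart set \<Rightarrow> bool" where
  "smooth_manifold A \<longleftrightarrow>
     finite_dimensional TYPE('c) \<and> smooth_atlas A \<and>
     (\<forall>c\<in>A. open (fst c) \<and> homeomorphism (fst c) (snd c ` fst c) (snd c) (chart_inv c))"

text \<open>Smoothness with respect to two families of charts. Openness of the sets
  \<open>snd c ` (fst c \<inter> f -` fst d)\<close> expresses continuity of \<open>f\<close> for the topologies induced by the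
  charts.\<close>

definition smooth_map ::
    "('m, 'c::real_normed_vector) chart set \<Rightarrow> ('n, 'd::real_normed_vector) chart set
      \<Rightarrow> ('m \<Rightarrow> 'n) \<Rightarrow> bool" where
  "smooth_map A B f \<longleftrightarrow>
     (\<forall>c\<in>A. \<forall>d\<in>B. open (snd c ` (fst c \<inter> f -` fst d)) \<and>
        smooth_on (snd d \<circ> f \<circ> chart_inv c) (snd c ` (fst c \<inter> f -` fst d)))"

definition smooth_functions :: "('m, 'c::real_normed_vector) chart set \<Rightarrow> ('m \<Rightarrow> real) set" where
  "smooth_functions A = {f. smooth_map A {(UNIV, id)} f}"


section \<open>The tangent bundle\<close>

text \<open>A tangent vector at \<open>x\<close> is the family of its coordinate representatives in all charts around
  \<open>x\<close>, related by the derivatives of the coordinate changes (and \<open>0\<close> by convention at all other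
  charts). The elements of the tangent bundle are pairs of a base point and a tangent vector there.\<close>

type_synonym ('m, 'c) tangent = "'m \<times> (('m, 'c) chart \<Rightarrow> 'c)"

definition tangent_space ::
    "('m, 'c::real_normed_vector) chart set \<Rightarrow> 'm \<Rightarrow> (('m, 'c) chart \<Rightarrow> 'c) set" where
  "tangent_space A x = {v.
     (\<forall>c. c \<notin> A \<or> x \<notin> fst c \<longrightarrow> v c = 0) \<and>
     (\<forall>c\<in>A. \<forall>d\<in>A. x \<in> fst c \<inter> fst d \<longrightarrow>
        v d = frechet_derivative (snd d \<circ> chart_inv c) (at (snd c x)) (v c))}"

definition tangent_bundle :: "('m, 'c::real_normed_vector) chart set \<Rightarrow> ('m, 'c) tangent set" where
  "tangent_bundle A = {(x, v). v \<in> tangent_space A x}"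

definition tangent_charts ::
    "('m, 'c::real_normed_vector) chart set \<Rightarrow> (('m, 'c) tangent, 'c \<times> 'c) chart set" where
  "tangent_charts A =
     (\<lambda>c. ({w \<in> tangent_bundle A. fst w \<in> fst c}, \<lambda>w. (snd c (fst w), snd w c))) ` A"

definition chart_at :: "('m, 'c) chart set \<Rightarrow> 'm \<Rightarrow> ('m, 'c) chart" where
  "chart_at A x = (SOME c. c \<in> A \<and> x \<in> fst c)"

text \<open>The differential of a function, as a map on the tangent bundle. By the compatibility condition on
  tangent vectors its value does not depend on the chart chosen.\<close>

definition differential ::
    "('m, 'c::real_normed_vector) chart set \<Rightarrow> ('m \<Rightarrow> real) \<Rightarrow> ('m, 'c) tangent \<Rightarrow> real" where
  "differential A f w =
     (let c = chart_at A (fst w)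
      in frechet_derivative (f \<circ> chart_inv c) (at (snd c (fst w))) (snd w c))"

definition contraction ::
    "('m \<Rightarrow> ('m, 'c) tangent) \<Rightarrow> (('m, 'c) tangent \<Rightarrow> real) \<Rightarrow> 'm \<Rightarrow> real" where
  "contraction X \<alpha> = (\<lambda>x. \<alpha> (X x))"

text \<open>The Lie derivative of a function with respect to a vector field: the derivative of the function in
  the direction of the field, computed in a chart (again independent of the chart).\<close>

definition lie_derivative ::
    "('m, 'c::real_normed_vector) chart set \<Rightarrow> ('m \<Rightarrow> ('m, 'c) tangent) \<Rightarrow> ('m \<Rightarrow> real)
      \<Rightarrow> 'm \<Rightarrow> real" where
  "lie_derivative A X f = (\<lambda>x.
     let c = chart_at A x
     in deriv (\<lambda>t. f (chart_inv c (snd c x + t *\<^sub>R snd (X x) c))) 0)"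


section \<open>Vector bundles\<close>

text \<open>The total space is the type \<open>'e\<close>, and \<open>vadd\<close>, \<open>vscale\<close> and \<open>vzero\<close> are the vector space
  operations of the fibres. A trivialization is represented by its open domain \<open>U\<close> in the base and the
  second component \<open>\<Phi>\<close> of the map \<open>e \<mapsto> (proj e, \<Phi> e)\<close> from the part of the total space over \<open>U\<close>
  to \<open>U \<times> 'f\<close>.\<close>

record ('m, 'c, 'e, 'f) vector_bundle =
  base_charts :: "('m, 'c) chart set"
  proj :: "'e \<Rightarrow> 'm"
  vadd :: "'e \<Rightarrow> 'e \<Rightarrow> 'e"
  vscale :: "real \<Rightarrow> 'e \<Rightarrow> 'e"
  vzero :: "'m \<Rightarrow> 'e"
  trivs :: "('m set \<times> ('e \<Rightarrow> 'f)) set"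

definition fibre :: "('m, 'c, 'e, 'f, 'z) vector_bundle_scheme \<Rightarrow> 'm \<Rightarrow> 'e set" where
  "fibre E x = {e. proj E e = x}"

definition bundle_charts ::
    "('m, 'c, 'e, 'f, 'z) vector_bundle_scheme \<Rightarrow> ('e, 'c \<times> 'f) chart set" where
  "bundle_charts E =
     (\<lambda>(c, t). (proj E -` (fst c \<inter> fst t), \<lambda>e. (snd c (proj E e), snd t e)))
       ` (base_charts E \<times> trivs E)"

text \<open>The smooth structure of the total space is the one given by the bundle charts. The vector space
  laws in the fibres need not be listed: they follow from the existence of linear bijections of every
  fibre with \<open>'f\<close>.\<close>

definition smooth_vector_bundle ::
    "('m::{t2_space,second_countable_topology}, 'c::real_normed_vector, 'e,
      'f::real_normed_vector, 'z) vector_bundle_scheme \<Rightarrow> bool" where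
  "smooth_vector_bundle E \<longleftrightarrow>
     smooth_manifold (base_charts E) \<and>
     finite_dimensional TYPE('f) \<and>
     (\<forall>x. vzero E x \<in> fibre E x \<and>
        (\<forall>a. \<forall>e\<in>fibre E x. vscale E a e \<in> fibre E x) \<and>
        (\<forall>e\<in>fibre E x. \<forall>e'\<in>fibre E x. vadd E e e' \<in> fibre E x)) \<and>
     (\<Union>t\<in>trivs E. fst t) = UNIV \<and>
     (\<forall>(U, \<Phi>)\<in>trivs E. open U \<and>
        (\<forall>x\<in>U. bij_betw \<Phi> (fibre E x) UNIV \<and>
           \<Phi> (vzero E x) = 0 \<and>
           (\<forall>a. \<forall>e\<in>fibre E x. \<Phi> (vscale E a e) = a *\<^sub>R \<Phi> e) \<and>
           (\<forall>e\<in>fibre E x. \<forall>e'\<in>fibre E x. \<Phi> (vadd E e e') = \<Phi> e + \<Phi> e'))) \<and>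
     smooth_atlas (bundle_charts E)"

definition sections ::
    "('m, 'c::real_normed_vector, 'e, 'f::real_normed_vector, 'z) vector_bundle_scheme
      \<Rightarrow> ('m \<Rightarrow> 'e) set" where
  "sections E = {s. (\<forall>x. s x \<in> fibre E x) \<and> smooth_map (base_charts E) (bundle_charts E) s}"

definition sec_add ::
    "('m, 'c, 'e, 'f, 'z) vector_bundle_scheme \<Rightarrow> ('m \<Rightarrow> 'e) \<Rightarrow> ('m \<Rightarrow> 'e) \<Rightarrow> 'm \<Rightarrow> 'e" where
  "sec_add E s t = (\<lambda>x. vadd E (s x) (t x))"

definition sec_mult ::
    "('m, 'c, 'e, 'f, 'z) vector_bundle_scheme \<Rightarrow> ('m \<Rightarrow> real) \<Rightarrow> ('m \<Rightarrow> 'e) \<Rightarrow> 'm \<Rightarrow> 'e" where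
  "sec_mult E f s = (\<lambda>x. vscale E (f x) (s x))"


section \<open>Lie algebroids\<close>

record ('m, 'c, 'e, 'f) lie_algebroid = "('m, 'c, 'e, 'f) vector_bundle" +
  bracket :: "('m \<Rightarrow> 'e) \<Rightarrow> ('m \<Rightarrow> 'e) \<Rightarrow> 'm \<Rightarrow> 'e"
  anchor :: "'e \<Rightarrow> ('m, 'c) tangent"

definition lie_bracket_on_sections ::
    "('m, 'c::real_normed_vector, 'e, 'f::real_normed_vector, 'z) lie_algebroid_scheme \<Rightarrow> bool" where
  "lie_bracket_on_sections E \<longleftrightarrow>
     (\<forall>s\<in>sections E. \<forall>t\<in>sections E. bracket E s t \<in> sections E) \<and>
     (\<forall>s\<in>sections E. \<forall>t\<in>sections E. \<forall>u\<in>sections E.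
        bracket E (sec_add E s t) u = sec_add E (bracket E s u) (bracket E t u) \<and>
        bracket E u (sec_add E s t) = sec_add E (bracket E u s) (bracket E u t)) \<and>
     (\<forall>a. \<forall>s\<in>sections E. \<forall>t\<in>sections E.
        bracket E (sec_mult E (\<lambda>_. a) s) t = sec_mult E (\<lambda>_. a) (bracket E s t) \<and>
        bracket E s (sec_mult E (\<lambda>_. a) t) = sec_mult E (\<lambda>_. a) (bracket E s t)) \<and>
     (\<forall>s\<in>sections E. bracket E s s = vzero E) \<and>
     (\<forall>s\<in>sections E. \<forall>t\<in>sections E. \<forall>u\<in>sections E.
        sec_add E (bracket E s (bracket E t u))
          (sec_add E (bracket E t (bracket E u s)) (bracket E u (bracket E s t))) = vzero E)"

text \<open>Smooth vector bundle maps from \<open>E\<close> to the tangent bundle of the base, over the identity.\<close>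

definition bundle_map_to_tangent ::
    "('m, 'c::real_normed_vector, 'e, 'f::real_normed_vector, 'z) vector_bundle_scheme
      \<Rightarrow> ('e \<Rightarrow> ('m, 'c) tangent) \<Rightarrow> bool" where
  "bundle_map_to_tangent E \<rho> \<longleftrightarrow>
     (\<forall>e. \<rho> e \<in> tangent_bundle (base_charts E) \<and> fst (\<rho> e) = proj E e) \<and>
     (\<forall>x. \<forall>e\<in>fibre E x. \<forall>e'\<in>fibre E x.
        snd (\<rho> (vadd E e e')) = (\<lambda>c. snd (\<rho> e) c + snd (\<rho> e') c)) \<and>
     (\<forall>a e. snd (\<rho> (vscale E a e)) = (\<lambda>c. a *\<^sub>R snd (\<rho> e) c)) \<and>
     smooth_map (bundle_charts E) (tangent_charts (base_charts E)) \<rho>"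

definition is_lie_algebroid ::
    "('m::{t2_space,second_countable_topology}, 'c::real_normed_vector, 'e,
      'f::real_normed_vector, 'z) lie_algebroid_scheme \<Rightarrow> bool" where
  "is_lie_algebroid E \<longleftrightarrow>
     smooth_vector_bundle E \<and>
     lie_bracket_on_sections E \<and>
     bundle_map_to_tangent E (anchor E) \<and>
     (\<forall>s\<in>sections E. \<forall>t\<in>sections E. \<forall>f\<in>smooth_functions (base_charts E).
        bracket E s (sec_mult E f t) =
          sec_add E (sec_mult E f (bracket E s t))
            (sec_mult E (lie_derivative (base_charts E) (anchor E \<circ> s) f) t))"


section \<open>Exterior forms\<close>

text \<open>A form of degree \<open>p\<close> is identified with an alternating map, multilinear over the smooth
  functions, from \<open>p\<close>-tuples (lists of length \<open>p\<close>) of smooth sections to smooth functions. So that equality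
  of forms is equality of functions, it is set to \<open>0\<close> on all other lists.\<close>

type_synonym ('m, 'e) form = "('m \<Rightarrow> 'e) list \<Rightarrow> 'm \<Rightarrow> real"

definition zero_form :: "('m, 'e) form" where
  "zero_form = (\<lambda>_ _. 0)"

definition section_tuples ::
    "('m, 'c::real_normed_vector, 'e, 'f::real_normed_vector, 'z) vector_bundle_scheme
      \<Rightarrow> nat \<Rightarrow> ('m \<Rightarrow> 'e) list set" where
  "section_tuples E p = {Vs. length Vs = p \<and> set Vs \<subseteq> sections E}"

definition alternating_forms ::
    "('m, 'c::real_normed_vector, 'e, 'f::real_normed_vector, 'z) vector_bundle_scheme
      \<Rightarrow> nat \<Rightarrow> ('m, 'e) form set" where
  "alternating_forms E p = {\<eta>.
     (\<forall>Vs. Vs \<notin> section_tuples E p \<longrightarrow> \<eta> Vs = (\<lambda>_. 0)) \<and>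
     (\<forall>Vs\<in>section_tuples E p. \<eta> Vs \<in> smooth_functions (base_charts E)) \<and>
     (\<forall>Vs\<in>section_tuples E p. \<forall>i<p. \<forall>s\<in>sections E. \<forall>t\<in>sections E.
        \<eta> (Vs[i := sec_add E s t]) = (\<lambda>x. \<eta> (Vs[i := s]) x + \<eta> (Vs[i := t]) x)) \<and>
     (\<forall>Vs\<in>section_tuples E p. \<forall>i<p. \<forall>f\<in>smooth_functions (base_charts E). \<forall>s\<in>sections E.
        \<eta> (Vs[i := sec_mult E f s]) = (\<lambda>x. f x * \<eta> (Vs[i := s]) x)) \<and>
     (\<forall>Vs\<in>section_tuples E p. \<forall>i<p. \<forall>j<p. i \<noteq> j \<and> Vs ! i = Vs ! j \<longrightarrow> \<eta> Vs = (\<lambda>_. 0))}"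

text \<open>A smooth function, as a form of degree \<open>0\<close>.\<close>

definition function_form :: "('m \<Rightarrow> real) \<Rightarrow> ('m, 'e) form" where
  "function_form f = (\<lambda>Vs. if Vs = [] then f else (\<lambda>_. 0))"

definition forms ::
    "('m, 'c::real_normed_vector, 'e, 'f::real_normed_vector, 'z) vector_bundle_scheme
      \<Rightarrow> int \<Rightarrow> ('m, 'e) form set" where
  "forms E p =
     (if p < 0 then {zero_form}
      else if p = 0 then function_form ` smooth_functions (base_charts E)
      else alternating_forms E (nat p))"

text \<open>The direct sum of the spaces of forms of all degrees: finitely supported families.\<close>

type_synonym ('m, 'e) graded_form = "int \<Rightarrow> ('m, 'e) form"

definition Omega ::
    "('m, 'c::real_normed_vector, 'e, 'f::real_normed_vector, 'z) vector_bundle_scheme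
      \<Rightarrow> ('m, 'e) graded_form set" where
  "Omega E = {\<omega>. (\<forall>p. \<omega> p \<in> forms E p) \<and> finite {p. \<omega> p \<noteq> zero_form}}"

definition homogeneous :: "int \<Rightarrow> ('m, 'e) form \<Rightarrow> ('m, 'e) graded_form" where
  "homogeneous p \<eta> = (\<lambda>q. if q = p then \<eta> else zero_form)"

definition graded_endomorphism_degree_0 ::
    "('m, 'c::real_normed_vector, 'e, 'f::real_normed_vector, 'z) vector_bundle_scheme
      \<Rightarrow> (('m, 'e) graded_form \<Rightarrow> ('m, 'e) graded_form) \<Rightarrow> bool" where
  "graded_endomorphism_degree_0 E L \<longleftrightarrow>
     (\<forall>\<omega>\<in>Omega E. L \<omega> \<in> Omega E) \<and>
     (\<forall>\<omega>\<in>Omega E. \<forall>\<omega>'\<in>Omega E.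
        L (\<lambda>p Vs x. \<omega> p Vs x + \<omega>' p Vs x) = (\<lambda>p Vs x. L \<omega> p Vs x + L \<omega>' p Vs x)) \<and>
     (\<forall>a. \<forall>\<omega>\<in>Omega E. L (\<lambda>p Vs x. a * \<omega> p Vs x) = (\<lambda>p Vs x. a * L \<omega> p Vs x)) \<and>
     (\<forall>p. \<forall>\<eta>\<in>forms E p. L (homogeneous p \<eta>) \<in> homogeneous p ` forms E p)"

end

theory Submission
  imports Defs
begin

text \<open>
  The formulas (i) and (ii) determine the operator on homogeneous elements, and linearity extends this to
  \<^term>\<open>Omega E\<close>, so the point is existence. The derivative \<open>D = L(\<rho> \<circ> V)\<close> of a smooth function is
  smooth and \<open>D\<close> is a derivation; smoothness is the chain rule in charts, where linear
  coordinates on the finite-dimensional model spaces are needed. In the right-hand side of (ii), the Leibniz rule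
  \<open>{V, f s} = f {V, s} + (D f) s\<close> produces a term that cancels the one coming from \<open>D(f g) = f D g + (D f) g\<close>,
  so the expression is multilinear over the smooth functions. It is alternating because, when two
  arguments coincide, the two summands in which one of them is bracketed with \<open>V\<close> cancel by
  antisymmetry, and all other summands vanish.
\<close>

section \<open>Calculus on finite-dimensional normed spaces\<close>

text \<open>Three obstacles shape the argument. The model spaces are normed spaces with a finite
  spanning set and no inner product, so even the continuity of coordinate functionals has to be won,
  by compactness, before a derivative can be expanded in a basis. Next, \<open>differential\<close>
  and \<open>lie_derivative\<close> evaluate in a chart that \<open>chart_at\<close> picks
  separately at every point, with no relation between neighbouring choices; smoothness of
  \<open>D f\<close> is out of reach until the value is known not to depend on the chart. Finally,
  (ii) refers to the operator on functions, which (i) already fixes; replacing it by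
  \<open>D\<close> gives the closed expression \<open>lie_form\<close>, which for
  \<open>p = 0\<close> has an empty sum and is (i) itself. Uniqueness is literal equality of
  functions because the candidates are \<open>extensional\<close> on \<open>Omega E\<close>.\<close>

lemma representation_bounded:
  fixes B :: "'a::real_normed_vector set"
  assumes fin: "finite B" and ind: "independent B" and sp: "span B = UNIV"
  shows "\<exists>K. \<forall>x. \<bar>representation B x b\<bar> \<le> norm x * K"
proof (cases "b \<in> B")
  case False
  then have "representation B x b = 0" for x
    using representation_ne_zero by blast
  then show ?thesis by (intro exI[of _ 0]) simp
next
  case True
  \<comment> \<open>\<open>S\<close> is the unit sphere of the maximum norm on coefficient families, compact by Tychonoff.\<close>
  define P where "P = Pi\<^sub>E UNIV (\<lambda>c. if c \<in> B then {-1..1} else {0::real})"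
  define S where "S = P \<inter> (\<Union>c\<in>B. {a. \<bar>a c\<bar> = 1})"
  define F :: "('a \<Rightarrow> real) \<Rightarrow> real" where "F a = norm (\<Sum>c\<in>B. a c *\<^sub>R c)" for a
  have "compactin (product_topology (\<lambda>i. euclidean) UNIV) P"
    unfolding P_def compactin_PiE by auto
  then have "compact P"
    by (simp add: euclidean_product_topology compactin_euclidean_iff)
  moreover have "closed (\<Union>c\<in>B. {a::'a \<Rightarrow> real. \<bar>a c\<bar> = 1})"
    by (intro closed_UN fin ballI closed_Collect_eq continuous_intros) auto
  ultimately have "compact S"
    unfolding S_def by (rule compact_Int_closed)
  moreover have "(\<lambda>c. if c = b then 1 else 0) \<in> S"
    using True by (auto simp: S_def P_def)
  then have "S \<noteq> {}" by blast
  moreover have "continuous_on S F"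
    unfolding F_def by (intro continuous_intros continuous_on_subset[OF continuous_on_product_coordinates]) auto
  ultimately obtain a0 where a0: "a0 \<in> S" "\<And>a. a \<in> S \<Longrightarrow> F a0 \<le> F a"
    using continuous_attains_inf by metis
  \<comment> \<open>The reciprocal of this minimum is the bound sought. It is positive because a
    vanishing combination would have all coefficients zero by independence, while every point of
    \<open>S\<close> has a coefficient of absolute value one.\<close>
  define m where "m = F a0"
  have "F a0 \<noteq> 0"
  proof
    assume "F a0 = 0"
    then have "\<forall>c\<in>B. a0 c = 0"
      using independentD[OF ind fin subset_refl] by (simp add: F_def)
    with a0(1) show False by (auto simp: S_def)
  qed
  then have m: "m > 0" unfolding m_def F_def by simp
  have "\<bar>representation B x b\<bar> \<le> norm x * (1 / m)" for x
  proof -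
    define r where "r = representation B x"
    define M where "M = Max ((\<lambda>c. \<bar>r c\<bar>) ` B)"
    have le: "\<bar>r c\<bar> \<le> M" if "c \<in> B" for c
      using that fin unfolding M_def by (intro Max_ge) auto
    have "M \<in> (\<lambda>c. \<bar>r c\<bar>) ` B"
      unfolding M_def using fin True by (intro Max_in) auto
    then obtain c where c: "c \<in> B" "M = \<bar>r c\<bar>" by auto
    have x: "x = (\<Sum>c\<in>B. r c *\<^sub>R c)"
      unfolding r_def using sum_representation_eq[OF ind _ fin subset_refl] sp by simp
    show ?thesis
    proof (cases "M = 0")
      case True
      then have "r b = 0" using le[OF \<open>b \<in> B\<close>] by simp
      then show ?thesis using m by (simp add: r_def)
    next
      case False
      then have M: "M > 0" using c by simp
      \<comment> \<open>Division by the largest coefficient moves the family onto \<open>S\<close>;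
        homogeneity of the norm then turns \<open>m \<le> F a\<close> into
        \<open>M * m \<le> norm x\<close>.\<close>
      define a where "a = (\<lambda>c. r c / M)"
      have off: "r d = 0" if "d \<notin> B" for d
        using that representation_ne_zero unfolding r_def by blast
      have "a \<in> P"
        using le M off by (fastforce simp: P_def a_def abs_le_iff field_simps PiE_iff)
      moreover have "\<bar>a c\<bar> = 1" using c M by (simp add: a_def)
      ultimately have "a \<in> S" using c unfolding S_def by blast
      then have "m \<le> F a" using a0 m_def by simp
      also have "F a = norm ((1 / M) *\<^sub>R x)"
        unfolding F_def a_def x scaleR_sum_right by (simp add: field_simps)
      also have "\<dots> = norm x / M" using M by simp
      finally have "M * m \<le> norm x" using M by (simp add: field_simps)
      then have "M \<le> norm x * (1 / m)" using m by (simp add: field_simps)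
      then show ?thesis using le[OF True] r_def by simp
    qed
  qed
  then show ?thesis by blast
qed

text \<open>This is the form in which finite dimension enters the calculus: with continuous linear
  coefficients \<open>\<phi> b\<close>, a derivative in a moving direction becomes a combination of
  derivatives in the fixed directions \<open>b\<close>. The basis is a maximal independent subset of
  the given spanning set.\<close>

lemma finite_dimensional_coordinates:
  assumes "finite_dimensional TYPE('a::real_normed_vector)"
  shows "\<exists>(B::'a set) \<phi>. (\<forall>b. bounded_linear (\<phi> b)) \<and> (\<forall>x. (\<Sum>b\<in>B. \<phi> b x *\<^sub>R b) = x)"
proof -
  obtain B0 :: "'a set" where B0: "finite B0" "span B0 = UNIV"
    using assms finite_dimensional_def by blast
  obtain B where B: "B \<subseteq> B0" "independent B" "B0 \<subseteq> span B"
    using maximal_independent_subset .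
  have fin: "finite B" using B(1) B0(1) finite_subset by blast
  have sp: "span B = UNIV"
    using B(3) B0(2) by (metis span_minimal subspace_span top.extremum_uniqueI)
  have "bounded_linear (\<lambda>x. representation B x b)" for b
  proof -
    obtain K where "\<forall>x. \<bar>representation B x b\<bar> \<le> norm x * K"
      using representation_bounded[OF fin B(2) sp] by blast
    then show ?thesis
      using representation_add[OF B(2)] representation_scale[OF B(2)] sp
      by (intro bounded_linear_intro[of _ K]) auto
  qed
  moreover have "(\<Sum>b\<in>B. representation B x b *\<^sub>R b) = x" for x
    using sum_representation_eq[OF B(2) _ fin subset_refl] sp by simp
  ultimately show ?thesis
    by (intro exI[of _ B] exI[of _ "\<lambda>b x. representation B x b"]) simp
qed

text \<open>Bundle charts take values in a product of two model spaces, and the chain rule through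
  the total space needs coordinates there.\<close>

lemma finite_dimensional_prod:
  assumes "finite_dimensional TYPE('a::real_normed_vector)"
    and "finite_dimensional TYPE('b::real_normed_vector)"
  shows "finite_dimensional TYPE('a \<times> 'b)"
proof -
  obtain B :: "'a set" where B: "finite B" "span B = UNIV"
    using assms(1) finite_dimensional_def by blast
  obtain C :: "'b set" where C: "finite C" "span C = UNIV"
    using assms(2) finite_dimensional_def by blast
  have "span (B \<times> {0} \<union> {0} \<times> C) = UNIV"
  proof -
    have "(x, y) \<in> span (B \<times> {0} \<union> {0} \<times> C)" for x y
    proof -
      have "linear (\<lambda>x::'a. (x, 0::'b))" "linear (\<lambda>y::'b. (0::'a, y))"
        by (auto intro!: linearI)
      then have "(\<lambda>x::'a. (x, 0::'b)) ` span B = span ((\<lambda>x. (x, 0)) ` B)"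
        "(\<lambda>y::'b. (0::'a, y)) ` span C = span ((\<lambda>y. (0, y)) ` C)"
        by (simp_all only: linear_span_image)
      moreover have "(\<lambda>x::'a. (x, 0::'b)) ` B = B \<times> {0}" "(\<lambda>y::'b. (0::'a, y)) ` C = {0} \<times> C"
        by auto
      moreover have "(x, 0::'b) \<in> (\<lambda>x::'a. (x, 0::'b)) ` span B" "(0, y) \<in> (\<lambda>y::'b. (0::'a, y)) ` span C"
        using B(2) C(2) by simp_all
      ultimately have "(x, 0::'b) \<in> span (B \<times> {0})" "(0::'a, y) \<in> span ({0} \<times> C)"
        by simp_all
      then have "(x, 0) \<in> span (B \<times> {0} \<union> {0} \<times> C)" "(0, y) \<in> span (B \<times> {0} \<union> {0} \<times> C)"
        using span_mono[of _ "B \<times> {0} \<union> {0} \<times> C"] by blast+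
      from span_add[OF this] show ?thesis by simp
    qed
    then show ?thesis by auto
  qed
  moreover have "finite (B \<times> {0::'b} \<union> {0::'a} \<times> C)" using B C by simp
  ultimately show ?thesis unfolding finite_dimensional_def by blast
qed

section \<open>Closure properties of maps of class C^k\<close>

lemma C_k_on_subset: "C_k_on k f S \<Longrightarrow> T \<subseteq> S \<Longrightarrow> C_k_on k f T"
  by (induction k arbitrary: f) (simp add: continuous_on_subset, simp, blast)

lemma C_k_on_cong:
  assumes "open S" "C_k_on k f S" "\<And>x. x \<in> S \<Longrightarrow> f x = g x"
  shows "C_k_on k g S"
proof (cases k)
  case 0
  then show ?thesis using assms continuous_on_cong by fastforce
next
  case (Suc k')
  then show ?thesis
    using assms by simp (meson has_derivative_transform_within_open)
qed

text \<open>The derivative at a point is unique, so the existential witness in \<open>C_k_on\<close>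
  can be replaced by \<open>frechet_derivative\<close>; openness of \<open>S\<close> lets the
  regularity pass from one to the other. A canonical derivative is what makes gluing possible, since
  different neighbourhoods would otherwise come with different witnesses.\<close>

lemma C_k_on_Suc_iff:
  assumes "open S"
  shows "C_k_on (Suc k) f S \<longleftrightarrow>
    (\<forall>x\<in>S. f differentiable (at x)) \<and> (\<forall>v. C_k_on k (\<lambda>x. frechet_derivative f (at x) v) S)"
proof
  assume "C_k_on (Suc k) f S"
  then obtain f' where f': "\<forall>x\<in>S. (f has_derivative f' x) (at x)" "\<forall>v. C_k_on k (\<lambda>x. f' x v) S"
    by auto
  have "f' x v = frechet_derivative f (at x) v" if "x \<in> S" for x v
    using f'(1) that frechet_derivative_at[of f "f' x" x] by simp
  then have "C_k_on k (\<lambda>x. frechet_derivative f (at x) v) S" for v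
    by (rule C_k_on_cong[OF assms f'(2)[rule_format, of v]])
  then show "(\<forall>x\<in>S. f differentiable (at x)) \<and> (\<forall>v. C_k_on k (\<lambda>x. frechet_derivative f (at x) v) S)"
    using f'(1) differentiableI by blast
qed (auto simp: frechet_derivative_works intro!: exI[of _ "\<lambda>x. frechet_derivative f (at x)"])

lemma C_k_on_local:
  assumes "open S" "\<And>x. x \<in> S \<Longrightarrow> \<exists>T. open T \<and> x \<in> T \<and> C_k_on k f T"
  shows "C_k_on k f S"
  using assms(2)
proof (induction k arbitrary: f)
  case 0
  have "isCont f x" if "x \<in> S" for x
    using 0[OF that] continuous_on_eq_continuous_at by auto
  then show ?case by (simp add: continuous_at_imp_continuous_on)
next
  case (Suc k)
  have "\<exists>T. open T \<and> x \<in> T \<and> f differentiable (at x) \<and>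
      (\<forall>v. C_k_on k (\<lambda>x. frechet_derivative f (at x) v) T)" if "x \<in> S" for x
    using Suc.prems[OF that] C_k_on_Suc_iff by blast
  with Suc.IH show ?case
    unfolding C_k_on_Suc_iff[OF assms(1)] by blast
qed

text \<open>The recursion constrains the derivatives and asks only differentiability of
  \<open>f\<close> itself, so lowering the order takes an induction that ends in continuity of
  differentiable maps. It supplies the undifferentiated factors in the product rule and the inner
  map in the chain rule.\<close>

lemma C_k_on_Suc_imp: "C_k_on (Suc k) f S \<Longrightarrow> C_k_on k f S"
proof (induction k arbitrary: f)
  case 0
  then show ?case
    by simp (meson continuous_at_imp_continuous_on has_derivative_continuous)
next
  case (Suc k)
  then show ?case unfolding C_k_on.simps(2)[of _ f] C_k_on.simps(2)[of "Suc k"] by blast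
qed

lemma C_k_on_const: "C_k_on k (\<lambda>_. c) S"
proof (induction k arbitrary: c)
  case (Suc k)
  then show ?case by (auto intro!: exI[of _ "\<lambda>_ _. 0"])
qed simp

lemma C_k_on_bounded_linear:
  assumes "bounded_linear L" "C_k_on k f S"
  shows "C_k_on k (\<lambda>x. L (f x)) S"
  using assms(2)
proof (induction k arbitrary: f)
  case 0
  then show ?case using assms(1) by (simp add: bounded_linear.continuous_on)
next
  case (Suc k)
  then obtain f' where f': "\<forall>x\<in>S. (f has_derivative f' x) (at x)" "\<forall>v. C_k_on k (\<lambda>x. f' x v) S"
    by auto
  have "\<forall>x\<in>S. ((\<lambda>x. L (f x)) has_derivative (\<lambda>v. L (f' x v))) (at x)"
    using f'(1) bounded_linear.has_derivative[OF assms(1)] by blast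
  moreover have "\<forall>v. C_k_on k (\<lambda>x. L (f' x v)) S"
    using f'(2) Suc.IH by blast
  ultimately show ?case unfolding C_k_on.simps by (intro exI[of _ "\<lambda>x v. L (f' x v)"]) simp
qed

lemma C_k_on_Pair:
  assumes "C_k_on k f S" "C_k_on k g S"
  shows "C_k_on k (\<lambda>x. (f x, g x)) S"
  using assms
proof (induction k arbitrary: f g)
  case 0
  then show ?case by (simp add: continuous_on_Pair)
next
  case (Suc k)
  then obtain f' g' where
    f': "\<forall>x\<in>S. (f has_derivative f' x) (at x)" "\<forall>v. C_k_on k (\<lambda>x. f' x v) S" and
    g': "\<forall>x\<in>S. (g has_derivative g' x) (at x)" "\<forall>v. C_k_on k (\<lambda>x. g' x v) S"
    by auto
  have "\<forall>x\<in>S. ((\<lambda>x. (f x, g x)) has_derivative (\<lambda>v. (f' x v, g' x v))) (at x)"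
    using f'(1) g'(1) has_derivative_Pair by blast
  moreover have "\<forall>v. C_k_on k (\<lambda>x. (f' x v, g' x v)) S"
    using f'(2) g'(2) Suc.IH by blast
  ultimately show ?case unfolding C_k_on.simps by (intro exI[of _ "\<lambda>x v. (f' x v, g' x v)"]) simp
qed

lemma C_k_on_add:
  assumes "C_k_on k f S" "C_k_on k g S"
  shows "C_k_on k (\<lambda>x. f x + g x) S"
proof -
  have "bounded_linear (\<lambda>p::'b \<times> 'b. fst p + snd p)"
    by (intro bounded_linear_add bounded_linear_fst bounded_linear_snd)
  from C_k_on_bounded_linear[OF this C_k_on_Pair[OF assms]] show ?thesis by simp
qed

lemma C_k_on_sum:
  assumes "\<And>i. i \<in> I \<Longrightarrow> C_k_on k (f i) S"
  shows "C_k_on k (\<lambda>x. \<Sum>i\<in>I. f i x) S"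
  using assms
  by (induction I rule: infinite_finite_induct) (simp_all add: C_k_on_const C_k_on_add)

lemma C_k_on_scaleR:
  assumes "C_k_on k f S" "C_k_on k g S"
  shows "C_k_on k (\<lambda>x. f x *\<^sub>R g x) S"
  using assms
proof (induction k arbitrary: f g)
  case 0
  then show ?case by (simp add: continuous_on_scaleR)
next
  case (Suc k)
  then obtain f' g' where
    f': "\<forall>x\<in>S. (f has_derivative f' x) (at x)" "\<forall>v. C_k_on k (\<lambda>x. f' x v) S" and
    g': "\<forall>x\<in>S. (g has_derivative g' x) (at x)" "\<forall>v. C_k_on k (\<lambda>x. g' x v) S"
    by auto
  have "\<forall>x\<in>S. ((\<lambda>x. f x *\<^sub>R g x) has_derivative (\<lambda>v. f x *\<^sub>R g' x v + f' x v *\<^sub>R g x)) (at x)"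
    using f'(1) g'(1) has_derivative_scaleR by blast
  moreover have "C_k_on k f S" "C_k_on k g S"
    using Suc.prems C_k_on_Suc_imp by blast+
  then have "\<forall>v. C_k_on k (\<lambda>x. f x *\<^sub>R g' x v + f' x v *\<^sub>R g x) S"
    by (intro allI C_k_on_add Suc.IH f'(2)[rule_format] g'(2)[rule_format])
  ultimately show ?case
    unfolding C_k_on.simps by (intro exI[of _ "\<lambda>x v. f x *\<^sub>R g' x v + f' x v *\<^sub>R g x"]) simp
qed

text \<open>In coordinates the chain rule reads \<open>D(g \<circ> f) v = (\<Sum>b. \<phi> b (Df v) *\<^sub>R Dg b)\<close>, which only
  involves the directional derivatives of \<open>g\<close> in constant directions.\<close>

lemma C_k_on_compose:
  fixes g :: "'b::real_normed_vector \<Rightarrow> 'c::real_normed_vector"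
  assumes fd: "finite_dimensional TYPE('b)"
    and "C_k_on k g T" "C_k_on k f S" "f ` S \<subseteq> T"
  shows "C_k_on k (\<lambda>x. g (f x)) S"
  using assms(2-)
proof (induction k arbitrary: g)
  case 0
  then show ?case by (auto intro: continuous_on_compose2)
next
  case (Suc k)
  obtain B :: "'b set" and \<phi> :: "'b \<Rightarrow> 'b \<Rightarrow> real" where
    B: "\<forall>b. bounded_linear (\<phi> b)" "\<forall>x. (\<Sum>b\<in>B. \<phi> b x *\<^sub>R b) = x"
    using finite_dimensional_coordinates[OF fd] by blast
  obtain f' g' where
    f': "\<forall>x\<in>S. (f has_derivative f' x) (at x)" "\<forall>v. C_k_on k (\<lambda>x. f' x v) S" and
    g': "\<forall>x\<in>T. (g has_derivative g' x) (at x)" "\<forall>v. C_k_on k (\<lambda>x. g' x v) T"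
    using Suc.prems by auto
  define h where "h x v = (\<Sum>b\<in>B. \<phi> b (f' x v) *\<^sub>R g' (f x) b)" for x v
  have "((\<lambda>x. g (f x)) has_derivative h x) (at x)" if "x \<in> S" for x
  proof -
    have g'x: "(g has_derivative g' (f x)) (at (f x))" using g' Suc.prems that by auto
    then have lin: "linear (g' (f x))" by (rule has_derivative_linear)
    have "h x = (\<lambda>v. g' (f x) (f' x v))"
    proof
      fix v
      have "g' (f x) (f' x v) = g' (f x) (\<Sum>b\<in>B. \<phi> b (f' x v) *\<^sub>R b)"
        using B(2)[rule_format, of "f' x v"] by simp
      then show "h x v = g' (f x) (f' x v)"
        by (simp add: h_def linear_sum[OF lin] linear_cmul[OF lin])
    qed
    then show ?thesis using has_derivative_compose[OF bspec[OF f'(1) that] g'x] by simp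
  qed
  \<comment> \<open>The induction hypothesis holds for every outer map, hence for the directional
    derivative of \<open>g\<close> in the fixed direction \<open>b\<close>.\<close>
  moreover have "C_k_on k (\<lambda>x. g' (f x) b) S" for b
    using Suc.IH[of "\<lambda>y. g' y b"] g'(2) Suc.prems(2,3) C_k_on_Suc_imp by blast
  then have "C_k_on k (\<lambda>x. h x v) S" for v
    unfolding h_def
    by (intro C_k_on_sum C_k_on_scaleR C_k_on_bounded_linear[OF B(1)[rule_format]] f'(2)[rule_format])
  ultimately show ?case by auto
qed

section \<open>Passage from finite order to smooth maps\<close>

lemma smooth_on_subset: "smooth_on f S \<Longrightarrow> T \<subseteq> S \<Longrightarrow> smooth_on f T"
  unfolding smooth_on_def using C_k_on_subset by metis

lemma smooth_on_cong:
  "open S \<Longrightarrow> smooth_on f S \<Longrightarrow> (\<And>x. x \<in> S \<Longrightarrow> f x = g x) \<Longrightarrow> smooth_on g S"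
  unfolding smooth_on_def by (intro allI C_k_on_cong[of S _ f g]) simp_all

lemma smooth_on_const: "smooth_on (\<lambda>_. c) S"
  by (simp add: smooth_on_def C_k_on_const)

lemma smooth_on_bounded_linear:
  "bounded_linear L \<Longrightarrow> smooth_on f S \<Longrightarrow> smooth_on (\<lambda>x. L (f x)) S"
  by (simp add: smooth_on_def C_k_on_bounded_linear)

lemma smooth_on_Pair: "smooth_on f S \<Longrightarrow> smooth_on g S \<Longrightarrow> smooth_on (\<lambda>x. (f x, g x)) S"
  by (simp add: smooth_on_def C_k_on_Pair)

lemma smooth_on_add: "smooth_on f S \<Longrightarrow> smooth_on g S \<Longrightarrow> smooth_on (\<lambda>x. f x + g x) S"
  by (simp add: smooth_on_def C_k_on_add)

lemma smooth_on_sum: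
  "(\<And>i. i \<in> I \<Longrightarrow> smooth_on (f i) S) \<Longrightarrow> smooth_on (\<lambda>x. \<Sum>i\<in>I. f i x) S"
  by (simp add: smooth_on_def C_k_on_sum)

lemma smooth_on_scaleR: "smooth_on f S \<Longrightarrow> smooth_on g S \<Longrightarrow> smooth_on (\<lambda>x. f x *\<^sub>R g x) S"
  by (simp add: smooth_on_def C_k_on_scaleR)

lemma smooth_on_compose:
  fixes g :: "'b::real_normed_vector \<Rightarrow> 'c::real_normed_vector"
  assumes "finite_dimensional TYPE('b)" "smooth_on g T" "smooth_on f S" "f ` S \<subseteq> T"
  shows "smooth_on (\<lambda>x. g (f x)) S"
  unfolding smooth_on_def
proof
  show "C_k_on k (\<lambda>x. g (f x)) S" for k
    using assms C_k_on_compose[OF assms(1), of k g T f S] by (simp add: smooth_on_def)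
qed

lemma smooth_on_local:
  assumes "open S" "\<And>x. x \<in> S \<Longrightarrow> \<exists>T. open T \<and> x \<in> T \<and> smooth_on f T"
  shows "smooth_on f S"
  unfolding smooth_on_def
proof
  show "C_k_on k f S" for k
    using assms by (intro C_k_on_local) (auto simp: smooth_on_def)
qed

lemma smooth_on_has_derivative:
  assumes "smooth_on f S" "x \<in> S"
  shows "(f has_derivative frechet_derivative f (at x)) (at x)"
proof -
  have "C_k_on (Suc 0) f S" using assms(1) smooth_on_def by blast
  then have "f differentiable (at x)" using assms(2) by (auto simp: differentiable_def)
  then show ?thesis by (simp add: frechet_derivative_works)
qed

lemma smooth_on_frechet_derivative:
  assumes "smooth_on f S" "open S"
  shows "smooth_on (\<lambda>x. frechet_derivative f (at x) v) S"
  unfolding smooth_on_def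
proof
  show "C_k_on k (\<lambda>x. frechet_derivative f (at x) v) S" for k
    using assms(1) C_k_on_Suc_iff[OF assms(2), of k f] unfolding smooth_on_def by blast
qed

text \<open>Here the direction moves with the point. Expanding \<open>X x\<close> in coordinates
  leaves a finite sum of products of smooth functions, each derivative taken in a constant
  direction.\<close>

lemma smooth_on_frechet_derivative_along:
  fixes f :: "'a::real_normed_vector \<Rightarrow> 'b::real_normed_vector"
  assumes "finite_dimensional TYPE('a)" "smooth_on f S" "open S" "smooth_on X S"
  shows "smooth_on (\<lambda>x. frechet_derivative f (at x) (X x)) S"
proof -
  obtain B :: "'a set" and \<phi> :: "'a \<Rightarrow> 'a \<Rightarrow> real" where
    B: "\<forall>b. bounded_linear (\<phi> b)" "\<forall>x. (\<Sum>b\<in>B. \<phi> b x *\<^sub>R b) = x"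
    using finite_dimensional_coordinates[OF assms(1)] by blast
  have "(\<Sum>b\<in>B. \<phi> b (X x) *\<^sub>R frechet_derivative f (at x) b) = frechet_derivative f (at x) (X x)"
    if "x \<in> S" for x
  proof -
    have lin: "linear (frechet_derivative f (at x))"
      using smooth_on_has_derivative[OF assms(2) that] by (rule has_derivative_linear)
    have "frechet_derivative f (at x) (X x) = frechet_derivative f (at x) (\<Sum>b\<in>B. \<phi> b (X x) *\<^sub>R b)"
      using B(2)[rule_format, of "X x"] by simp
    then show ?thesis by (simp add: linear_sum[OF lin] linear_cmul[OF lin])
  qed
  moreover have "smooth_on (\<lambda>x. \<Sum>b\<in>B. \<phi> b (X x) *\<^sub>R frechet_derivative f (at x) b) S"
    by (intro smooth_on_sum smooth_on_scaleR smooth_on_bounded_linear[OF B(1)[rule_format]] assms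
        smooth_on_frechet_derivative)
  ultimately show ?thesis by (rule smooth_on_cong[OF assms(3), rotated])
qed


section \<open>Smooth functions and derivatives along vector fields\<close>

lemma
  assumes "smooth_manifold A" "c \<in> A"
  shows chart_inv_chart: "x \<in> fst c \<Longrightarrow> chart_inv c (snd c x) = x"
    and chart_inv_in: "y \<in> snd c ` fst c \<Longrightarrow> chart_inv c y \<in> fst c"
    and chart_chart_inv: "y \<in> snd c ` fst c \<Longrightarrow> snd c (chart_inv c y) = y"
  using assms
  by (auto simp: smooth_manifold_def smooth_atlas_def chart_inv_def inv_into_f_f)

lemma manifold_chart_at:
  assumes "smooth_manifold A"
  shows "chart_at A x \<in> A" "x \<in> fst (chart_at A x)"
proof -
  have "x \<in> (\<Union>c\<in>A. fst c)"
    using assms by (simp add: smooth_manifold_def smooth_atlas_def)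
  then have "\<exists>c. c \<in> A \<and> x \<in> fst c" by blast
  then have "chart_at A x \<in> A \<and> x \<in> fst (chart_at A x)"
    unfolding chart_at_def by (rule someI_ex)
  then show "chart_at A x \<in> A" "x \<in> fst (chart_at A x)" by simp_all
qed

lemma manifold_overlap:
  assumes "smooth_manifold A" "c \<in> A" "d \<in> A"
  shows "open (snd c ` (fst c \<inter> fst d))"
    and "smooth_on (\<lambda>y. snd d (chart_inv c y)) (snd c ` (fst c \<inter> fst d))"
  using assms by (auto simp: smooth_manifold_def smooth_atlas_def comp_def)

lemma manifold_chart_open:
  assumes "smooth_manifold A" "c \<in> A"
  shows "open (snd c ` fst c)"
  using manifold_overlap(1)[OF assms assms(2)] by simp

lemma smooth_functions_iff:
  assumes "smooth_manifold A"
  shows "f \<in> smooth_functions A \<longleftrightarrow> (\<forall>c\<in>A. smooth_on (\<lambda>y. f (chart_inv c y)) (snd c ` fst c))"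
  using manifold_chart_open[OF assms] by (simp add: smooth_functions_def smooth_map_def comp_def)

lemma smooth_functions_const: "smooth_manifold A \<Longrightarrow> (\<lambda>_. a) \<in> smooth_functions A"
  by (simp add: smooth_functions_iff smooth_on_const)

lemma smooth_functions_add:
  "smooth_manifold A \<Longrightarrow> f \<in> smooth_functions A \<Longrightarrow> g \<in> smooth_functions A \<Longrightarrow>
    (\<lambda>x. f x + g x) \<in> smooth_functions A"
  by (simp add: smooth_functions_iff smooth_on_add)

lemma smooth_functions_mult:
  assumes "smooth_manifold A" "f \<in> smooth_functions A" "g \<in> smooth_functions A"
  shows "(\<lambda>x. f x * g x) \<in> smooth_functions A"
  using assms(2,3)
  by (simp add: smooth_functions_iff[OF assms(1)] smooth_on_scaleR[where 'b=real, simplified])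

lemma smooth_functions_sum:
  "smooth_manifold A \<Longrightarrow> (\<And>i. i \<in> I \<Longrightarrow> f i \<in> smooth_functions A) \<Longrightarrow>
    (\<lambda>x. \<Sum>i\<in>I. f i x) \<in> smooth_functions A"
  by (simp add: smooth_functions_iff smooth_on_sum)

lemma smooth_functions_diff:
  assumes "smooth_manifold A" "f \<in> smooth_functions A" "g \<in> smooth_functions A"
  shows "(\<lambda>x. f x - g x) \<in> smooth_functions A"
  using smooth_functions_add[OF assms(1,2)
      smooth_functions_mult[OF assms(1) smooth_functions_const[OF assms(1), of "-1"] assms(3)]]
  by simp

section \<open>The differential: independence of the chart, product rule, smoothness\<close>

lemma smooth_function_has_derivative:
  assumes "smooth_manifold A" "f \<in> smooth_functions A" "c \<in> A" "x \<in> fst c"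
  shows "((\<lambda>y. f (chart_inv c y)) has_derivative
    frechet_derivative (\<lambda>y. f (chart_inv c y)) (at (snd c x))) (at (snd c x))"
  using assms by (intro smooth_on_has_derivative[of _ "snd c ` fst c"]) (auto simp: smooth_functions_iff)

lemma differential_eqI:
  assumes "c = chart_at A (fst w)"
    and "((\<lambda>y. f (chart_inv c y)) has_derivative D) (at (snd c (fst w)))"
  shows "differential A f w = D (snd w c)"
  using frechet_derivative_at[OF assms(2)] assms(1) by (simp add: differential_def comp_def Let_def)

text \<open>In the chart \<open>d\<close> selected by \<open>chart_at\<close>, the function is its
  expression in \<open>c\<close> composed with the transition map \<open>\<kappa>\<close>, and the
  compatibility condition on tangent vectors says that the derivative of \<open>\<kappa>\<close>
  carries the \<open>d\<close>-component of \<open>w\<close> to its \<open>c\<close>-component. This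
  allows a single chart to be used on its whole domain, as smoothness requires.\<close>

lemma differential_chart:
  assumes A: "smooth_manifold A" and f: "f \<in> smooth_functions A" and w: "w \<in> tangent_bundle A"
    and c: "c \<in> A" "fst w \<in> fst c"
  shows "differential A f w =
    frechet_derivative (\<lambda>y. f (chart_inv c y)) (at (snd c (fst w))) (snd w c)"
proof -
  define x d T where "x = fst w" and "d = chart_at A x" and "T = snd d ` (fst d \<inter> fst c)"
  have d: "d \<in> A" "x \<in> fst d" using manifold_chart_at[OF A] d_def by auto
  have x: "x \<in> fst c" "chart_inv d (snd d x) = x"
    using c(2) x_def chart_inv_chart[OF A d] by auto
  define \<kappa> where "\<kappa> = (\<lambda>y. snd c (chart_inv d y))"
  have T: "open T" "snd d x \<in> T" using manifold_overlap(1)[OF A d(1) c(1)] T_def d x by auto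
  have "(\<kappa> has_derivative frechet_derivative \<kappa> (at (snd d x))) (at (snd d x))"
    using manifold_overlap(2)[OF A d(1) c(1)] T(2) smooth_on_has_derivative
    unfolding T_def \<kappa>_def by blast
  moreover have "((\<lambda>y. f (chart_inv c y)) has_derivative
      frechet_derivative (\<lambda>y. f (chart_inv c y)) (at (snd c x))) (at (\<kappa> (snd d x)))"
    using smooth_function_has_derivative[OF A f c(1) x(1)] x by (simp add: \<kappa>_def)
  ultimately have "((\<lambda>y. f (chart_inv c (\<kappa> y))) has_derivative
      (\<lambda>v. frechet_derivative (\<lambda>y. f (chart_inv c y)) (at (snd c x))
        (frechet_derivative \<kappa> (at (snd d x)) v))) (at (snd d x))"
    by (rule has_derivative_compose)
  moreover have "f (chart_inv c (\<kappa> y)) = f (chart_inv d y)" if "y \<in> T" for y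
  proof -
    have "chart_inv d y \<in> fst c"
      using that chart_inv_chart[OF A d(1)] unfolding T_def by auto
    then show ?thesis using chart_inv_chart[OF A c(1)] by (simp add: \<kappa>_def)
  qed
  ultimately have D: "((\<lambda>y. f (chart_inv d y)) has_derivative
      (\<lambda>v. frechet_derivative (\<lambda>y. f (chart_inv c y)) (at (snd c x))
        (frechet_derivative \<kappa> (at (snd d x)) v))) (at (snd d x))"
    by (rule has_derivative_transform_within_open[OF _ T])
  have "snd w c = frechet_derivative \<kappa> (at (snd d x)) (snd w d)"
  proof -
    have "snd w \<in> tangent_space A x" using w by (auto simp: tangent_bundle_def x_def)
    then have "\<forall>c\<in>A. \<forall>d\<in>A. x \<in> fst c \<inter> fst d \<longrightarrow>
        snd w d = frechet_derivative (snd d \<circ> chart_inv c) (at (snd c x)) (snd w c)"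
      unfolding tangent_space_def by blast
    from this[rule_format, OF d(1) c(1)] show ?thesis
      using d(2) x(1) by (simp add: \<kappa>_def comp_def)
  qed
  then show ?thesis
    using differential_eqI[OF _ D[unfolded x_def]] d_def x_def by simp
qed

text \<open>Since \<open>X x\<close> sits over \<open>x\<close>, both sides use the same chart, and
  the chain rule along the straight line through \<open>snd c x\<close> suffices; no change of chart
  occurs.\<close>

lemma lie_derivative_eq_differential:
  assumes A: "smooth_manifold A" and f: "f \<in> smooth_functions A" and X: "fst (X x) = x"
  shows "lie_derivative A X f x = differential A f (X x)"
proof -
  define c where "c = chart_at A x"
  define F where "F = (\<lambda>y. f (chart_inv c y))"
  define D where "D = frechet_derivative F (at (snd c x))"
  define v where "v = snd (X x) c"
  have D: "(F has_derivative D) (at (snd c x))"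
    using smooth_function_has_derivative[OF A f manifold_chart_at[OF A]] by (simp add: F_def D_def c_def)
  have "((\<lambda>t. snd c x + t *\<^sub>R v) has_derivative (\<lambda>t. t *\<^sub>R v)) (at 0)"
    by (auto intro!: derivative_eq_intros)
  moreover have "(F has_derivative D) (at (snd c x + 0 *\<^sub>R v))" using D by simp
  ultimately have "((\<lambda>t. F (snd c x + t *\<^sub>R v)) has_derivative (\<lambda>t. D (t *\<^sub>R v))) (at 0)"
    by (rule has_derivative_compose)
  moreover have "(\<lambda>t. D (t *\<^sub>R v)) = (*) (D v)"
    using linear_cmul[OF has_derivative_linear[OF D]] by auto
  ultimately have "deriv (\<lambda>t. F (snd c x + t *\<^sub>R v)) 0 = D v"
    by (intro DERIV_imp_deriv) (simp add: has_field_derivative_def)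
  moreover have "differential A f (X x) = D v"
    using differential_eqI[of c A "X x" f D] D by (simp add: X c_def v_def F_def)
  ultimately show ?thesis
    by (simp add: lie_derivative_def Let_def c_def F_def v_def)
qed

lemma differential_const: "differential A (\<lambda>_. a) w = 0"
  by (rule differential_eqI[OF refl, where D = "\<lambda>_. 0"]) simp

lemma differential_add:
  assumes A: "smooth_manifold A" and fg: "f \<in> smooth_functions A" "g \<in> smooth_functions A"
  shows "differential A (\<lambda>x. f x + g x) w = differential A f w + differential A g w"
proof -
  define c where "c = chart_at A (fst w)"
  have c: "c \<in> A" "fst w \<in> fst c" using manifold_chart_at[OF A] c_def by auto
  note D = fg[THEN smooth_function_has_derivative[OF A _ c]]
  show ?thesis
    using differential_eqI[OF c_def has_derivative_add[OF D]] D[THEN differential_eqI[OF c_def]]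
    by simp
qed

lemma differential_mult:
  assumes A: "smooth_manifold A" and fg: "f \<in> smooth_functions A" "g \<in> smooth_functions A"
  shows "differential A (\<lambda>x. f x * g x) w =
    f (fst w) * differential A g w + differential A f w * g (fst w)"
proof -
  define c where "c = chart_at A (fst w)"
  have c: "c \<in> A" "fst w \<in> fst c" using manifold_chart_at[OF A] c_def by auto
  note D = fg[THEN smooth_function_has_derivative[OF A _ c]]
  show ?thesis
    using differential_eqI[OF c_def has_derivative_mult[OF D]] D[THEN differential_eqI[OF c_def]]
    by (simp add: chart_inv_chart[OF A c])
qed

text \<open>On the domain of a fixed chart, \<open>differential_chart\<close> removes the pointwise
  choice of charts; what remains is the derivative of a smooth local expression along a smooth
  coordinate field.\<close>

lemma smooth_differential_along:
  fixes A :: "('m::{t2_space,second_countable_topology}, 'c::real_normed_vector) chart set"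
  assumes A: "smooth_manifold A" and f: "f \<in> smooth_functions A"
    and X: "\<And>x. X x \<in> tangent_bundle A" "\<And>x. fst (X x) = x"
    and smooth: "\<And>c. c \<in> A \<Longrightarrow> smooth_on (\<lambda>y. snd (X (chart_inv c y)) c) (snd c ` fst c)"
  shows "(\<lambda>x. differential A f (X x)) \<in> smooth_functions A"
  unfolding smooth_functions_iff[OF A]
proof
  fix c assume c: "c \<in> A"
  let ?S = "snd c ` fst c"
  have fd: "finite_dimensional TYPE('c)" using A smooth_manifold_def by blast
  have "smooth_on (\<lambda>y. f (chart_inv c y)) ?S" using f c smooth_functions_iff[OF A] by blast
  from smooth_on_frechet_derivative_along[OF fd this manifold_chart_open[OF A c] smooth[OF c]]
  have "smooth_on (\<lambda>y. frechet_derivative (\<lambda>y. f (chart_inv c y)) (at y) (snd (X (chart_inv c y)) c)) ?S" .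
  then show "smooth_on (\<lambda>y. differential A f (X (chart_inv c y))) ?S"
  proof (rule smooth_on_cong[OF manifold_chart_open[OF A c]])
    fix y assume "y \<in> ?S"
    then show "frechet_derivative (\<lambda>y. f (chart_inv c y)) (at y) (snd (X (chart_inv c y)) c) =
        differential A f (X (chart_inv c y))"
      using differential_chart[OF A f X(1) c] X(2) chart_inv_in[OF A c] chart_chart_inv[OF A c]
      by simp
  qed
qed


section \<open>Sections\<close>

text \<open>A section covers the identity, so the preimage of a bundle chart domain is the set
  \<open>fst d \<inter> fst t\<close> of the base over which that domain lies. This reduces
  smoothness to local representatives on explicit overlaps.\<close>

lemma sections_iff:
  "s \<in> sections E \<longleftrightarrow> (\<forall>x. s x \<in> fibre E x) \<and>
    (\<forall>c\<in>base_charts E. \<forall>d\<in>base_charts E. \<forall>t\<in>trivs E.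
      open (snd c ` (fst c \<inter> (fst d \<inter> fst t))) \<and>
      smooth_on (\<lambda>y. (snd d (proj E (s (chart_inv c y))), snd t (s (chart_inv c y))))
        (snd c ` (fst c \<inter> (fst d \<inter> fst t))))"
proof (cases "\<forall>x. s x \<in> fibre E x")
  case True
  then have W: "s -` (proj E -` W) = W" for W by (auto simp: fibre_def)
  show ?thesis
    unfolding sections_def smooth_map_def bundle_charts_def
    by (simp only: mem_Collect_eq ball_simps split_paired_Ball_Sigma prod.case fst_conv snd_conv
        W True comp_def)
qed (unfold sections_def, blast)

lemma smooth_vector_bundle_trivE:
  assumes "smooth_vector_bundle E"
  obtains t where "t \<in> trivs E" "x \<in> fst t"
proof -
  have "x \<in> (\<Union>t\<in>trivs E. fst t)" using assms by (simp add: smooth_vector_bundle_def)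
  then show thesis using that by blast
qed

lemma smooth_vector_bundle_base: "smooth_vector_bundle E \<Longrightarrow> smooth_manifold (base_charts E)"
  by (simp add: smooth_vector_bundle_def)

lemma smooth_vector_bundle_fibre:
  assumes "smooth_vector_bundle E" "e \<in> fibre E x" "e' \<in> fibre E x"
  shows "vadd E e e' \<in> fibre E x" "vscale E a e \<in> fibre E x" "vzero E x \<in> fibre E x"
  using assms by (simp_all add: smooth_vector_bundle_def)

lemma smooth_vector_bundle_triv:
  assumes "smooth_vector_bundle E" "t \<in> trivs E" "x \<in> fst t" "e \<in> fibre E x" "e' \<in> fibre E x"
  shows "snd t (vadd E e e') = snd t e + snd t e'" "snd t (vscale E a e) = a *\<^sub>R snd t e"
  using assms by (simp_all add: smooth_vector_bundle_def case_prod_beta)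

lemma section_smooth:
  assumes "s \<in> sections E" "c \<in> base_charts E" "d \<in> base_charts E" "t \<in> trivs E"
  shows "open (snd c ` (fst c \<inter> (fst d \<inter> fst t)))"
    and "smooth_on (\<lambda>y. snd d (proj E (s (chart_inv c y)))) (snd c ` (fst c \<inter> (fst d \<inter> fst t)))"
    and "smooth_on (\<lambda>y. snd t (s (chart_inv c y))) (snd c ` (fst c \<inter> (fst d \<inter> fst t)))"
proof -
  show "open (snd c ` (fst c \<inter> (fst d \<inter> fst t)))" using assms sections_iff by blast
  have "smooth_on (\<lambda>y. (snd d (proj E (s (chart_inv c y))), snd t (s (chart_inv c y))))
        (snd c ` (fst c \<inter> (fst d \<inter> fst t)))" using assms sections_iff by blast
  from smooth_on_bounded_linear[OF bounded_linear_fst this] smooth_on_bounded_linear[OF bounded_linear_snd this]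
  show "smooth_on (\<lambda>y. snd d (proj E (s (chart_inv c y)))) (snd c ` (fst c \<inter> (fst d \<inter> fst t)))"
    "smooth_on (\<lambda>y. snd t (s (chart_inv c y))) (snd c ` (fst c \<inter> (fst d \<inter> fst t)))"
    by simp_all
qed

lemma section_fibre: "s \<in> sections E \<Longrightarrow> s x \<in> fibre E x"
  by (simp add: sections_def)

text \<open>Trivializations are linear on fibres, so the local representative of the sum is the sum
  of the local representatives.\<close>

lemma sec_add_in_sections:
  assumes E: "smooth_vector_bundle E" and s: "s \<in> sections E" and r: "r \<in> sections E"
  shows "sec_add E s r \<in> sections E"
  unfolding sections_iff
proof (intro conjI allI ballI)
  have fib: "s x \<in> fibre E x" "r x \<in> fibre E x" for x
    using s r by (simp_all add: section_fibre)
  then show 1: "sec_add E s r x \<in> fibre E x" for x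
    using smooth_vector_bundle_fibre(1)[OF E] by (simp add: sec_add_def)
  fix c d t assume c: "c \<in> base_charts E" and d: "d \<in> base_charts E" and t: "t \<in> trivs E"
  let ?S = "snd c ` (fst c \<inter> (fst d \<inter> fst t))"
  show S: "open ?S" using section_smooth(1)[OF s c d t] .
  show "smooth_on (\<lambda>y. (snd d (proj E (sec_add E s r (chart_inv c y))),
      snd t (sec_add E s r (chart_inv c y)))) ?S"
  proof (rule smooth_on_cong[OF S smooth_on_Pair[OF section_smooth(2)[OF s c d t]
          smooth_on_add[OF section_smooth(3)[OF s c d t] section_smooth(3)[OF r c d t]]]])
    fix y assume "y \<in> ?S"
    then have "chart_inv c y \<in> fst t"
      using chart_inv_chart[OF smooth_vector_bundle_base[OF E] c] by auto
    then show "(snd d (proj E (s (chart_inv c y))), snd t (s (chart_inv c y)) + snd t (r (chart_inv c y))) =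
        (snd d (proj E (sec_add E s r (chart_inv c y))), snd t (sec_add E s r (chart_inv c y)))"
      using smooth_vector_bundle_triv(1)[OF E t _ fib] fib 1
      by (simp add: sec_add_def fibre_def)
  qed
qed

lemma sec_mult_in_sections:
  assumes E: "smooth_vector_bundle E" and f: "f \<in> smooth_functions (base_charts E)"
    and s: "s \<in> sections E"
  shows "sec_mult E f s \<in> sections E"
  unfolding sections_iff
proof (intro conjI allI ballI)
  have fib: "s x \<in> fibre E x" for x by (rule section_fibre[OF s])
  show 1: "sec_mult E f s x \<in> fibre E x" for x
    using smooth_vector_bundle_fibre(2)[OF E fib fib] by (simp add: sec_mult_def)
  fix c d t assume c: "c \<in> base_charts E" and d: "d \<in> base_charts E" and t: "t \<in> trivs E"
  let ?S = "snd c ` (fst c \<inter> (fst d \<inter> fst t))"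
  show S: "open ?S" using section_smooth(1)[OF s c d t] .
  have "smooth_on (\<lambda>y. f (chart_inv c y)) (snd c ` fst c)"
    using f c smooth_functions_iff[OF smooth_vector_bundle_base[OF E]] by blast
  then have fS: "smooth_on (\<lambda>y. f (chart_inv c y)) ?S"
    by (rule smooth_on_subset) auto
  show "smooth_on (\<lambda>y. (snd d (proj E (sec_mult E f s (chart_inv c y))),
      snd t (sec_mult E f s (chart_inv c y)))) ?S"
  proof (rule smooth_on_cong[OF S smooth_on_Pair[OF section_smooth(2)[OF s c d t]
          smooth_on_scaleR[OF fS section_smooth(3)[OF s c d t]]]])
    fix y assume "y \<in> ?S"
    then have "chart_inv c y \<in> fst t"
      using chart_inv_chart[OF smooth_vector_bundle_base[OF E] c] by auto
    then show "(snd d (proj E (s (chart_inv c y))), f (chart_inv c y) *\<^sub>R snd t (s (chart_inv c y))) =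
        (snd d (proj E (sec_mult E f s (chart_inv c y))), snd t (sec_mult E f s (chart_inv c y)))"
      using smooth_vector_bundle_triv(2)[OF E t _ fib fib] fib 1
      by (simp add: sec_mult_def fibre_def)
  qed
qed

text \<open>Smoothness of \<open>\<rho>\<close> is stated between charts of the total spaces, and a
  chart of \<open>E\<close> exists only over a trivializing set, which need not contain the whole
  domain of \<open>c\<close>. Hence the argument is local: near each point the representative of
  \<open>\<rho>\<close> is composed with that of \<open>s\<close>, and the second component is
  kept.\<close>

lemma smooth_tangent_image_of_section:
  fixes E :: "('m::{t2_space,second_countable_topology}, 'c::real_normed_vector, 'e,
    'f::real_normed_vector, 'z) vector_bundle_scheme"
  assumes E: "smooth_vector_bundle E" and \<rho>: "bundle_map_to_tangent E \<rho>"
    and s: "s \<in> sections E" and c: "c \<in> base_charts E"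
  shows "smooth_on (\<lambda>y. snd (\<rho> (s (chart_inv c y))) c) (snd c ` fst c)"
proof (rule smooth_on_local)
  note A = smooth_vector_bundle_base[OF E]
  show "open (snd c ` fst c)" by (rule manifold_chart_open[OF A c])
  fix y assume "y \<in> snd c ` fst c"
  then obtain x where x: "x \<in> fst c" "y = snd c x" by blast
  obtain t where t: "t \<in> trivs E" "x \<in> fst t" using smooth_vector_bundle_trivE[OF E] .
  \<comment> \<open>The repeated \<open>fst c\<close> comes from using \<open>c\<close> both on the
    base and in the bundle chart, the instance \<open>d = c\<close> of
    \<open>section_smooth\<close>.\<close>
  define T where "T = snd c ` (fst c \<inter> (fst c \<inter> fst t))"
  define D where "D = proj E -` (fst c \<inter> fst t)"
  define \<beta> where "\<beta> = (\<lambda>e. (snd c (proj E e), snd t e))"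
  define R where "R = (\<lambda>w::('m, 'c) tangent. (snd c (fst w), snd w c))"
  define R0 where "R0 = {w \<in> tangent_bundle (base_charts E). fst w \<in> fst c}"
  have b: "(D, \<beta>) \<in> bundle_charts E"
    unfolding bundle_charts_def D_def \<beta>_def using c t(1) by (intro image_eqI[of _ _ "(c, t)"]) auto
  then have "inj_on \<beta> D"
    using E unfolding smooth_vector_bundle_def smooth_atlas_def by force
  then have inv: "chart_inv (D, \<beta>) (\<beta> e) = e" if "e \<in> D" for e
    using that by (simp add: chart_inv_def)
  have "(R0, R) \<in> tangent_charts (base_charts E)"
    unfolding tangent_charts_def R0_def R_def using c by blast
  then have sm: "smooth_on (\<lambda>z. R (\<rho> (chart_inv (D, \<beta>) z))) (\<beta> ` (D \<inter> \<rho> -` R0))"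
    using \<rho> b unfolding bundle_map_to_tangent_def smooth_map_def comp_def by fastforce
  \<comment> \<open>As \<open>\<rho>\<close> covers the identity, all of \<open>D\<close> already
    lands over \<open>fst c\<close>.\<close>
  have "D \<inter> \<rho> -` R0 = D"
    using \<rho> unfolding bundle_map_to_tangent_def D_def R0_def by auto
  then have sm: "smooth_on (\<lambda>z. R (\<rho> (chart_inv (D, \<beta>) z))) (\<beta> ` D)" using sm by simp
  have sD: "s (chart_inv c z) \<in> D" if "z \<in> T" for z
    using that section_fibre[OF s] chart_inv_chart[OF A c] by (auto simp: T_def D_def fibre_def)
  have fd: "finite_dimensional TYPE('c \<times> 'f)"
    using E A finite_dimensional_prod unfolding smooth_vector_bundle_def smooth_manifold_def by blast
  have T: "open T" using section_smooth(1)[OF s c c t(1)] T_def by simp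
  have "smooth_on (\<lambda>z. \<beta> (s (chart_inv c z))) T"
    using smooth_on_Pair[OF section_smooth(2,3)[OF s c c t(1)]] by (simp add: \<beta>_def T_def)
  then have "smooth_on (\<lambda>z. R (\<rho> (chart_inv (D, \<beta>) (\<beta> (s (chart_inv c z)))))) T"
    by (rule smooth_on_compose[OF fd sm]) (use sD in auto)
  from smooth_on_bounded_linear[OF bounded_linear_snd this]
  have "smooth_on (\<lambda>z. snd (\<rho> (s (chart_inv c z))) c) T"
    by (rule smooth_on_cong[OF T]) (simp add: inv sD R_def)
  moreover have "y \<in> T" using x t T_def by blast
  ultimately show "\<exists>T. open T \<and> y \<in> T \<and> smooth_on (\<lambda>y. snd (\<rho> (s (chart_inv c y))) c) T"
    using T by blast
qed


section \<open>Alternating forms\<close>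

lemma section_tuples_update:
  "Vs \<in> section_tuples E p \<Longrightarrow> s \<in> sections E \<Longrightarrow> Vs[i := s] \<in> section_tuples E p"
  unfolding section_tuples_def using set_update_subset_insert[of Vs i s] by auto

lemma section_tuples_nth: "Vs \<in> section_tuples E p \<Longrightarrow> i < p \<Longrightarrow> Vs ! i \<in> sections E"
  unfolding section_tuples_def using nth_mem by blast

lemma section_tuples_length: "Vs \<in> section_tuples E p \<Longrightarrow> length Vs = p"
  by (simp add: section_tuples_def)

lemma alternating_forms_off:
  "\<eta> \<in> alternating_forms E p \<Longrightarrow> Vs \<notin> section_tuples E p \<Longrightarrow> \<eta> Vs = (\<lambda>_. 0)"
  and alternating_forms_smooth:
  "\<eta> \<in> alternating_forms E p \<Longrightarrow> Vs \<in> section_tuples E p \<Longrightarrow> \<eta> Vs \<in> smooth_functions (base_charts E)"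
  and alternating_forms_add:
  "\<eta> \<in> alternating_forms E p \<Longrightarrow> Vs \<in> section_tuples E p \<Longrightarrow> i < p \<Longrightarrow> s \<in> sections E \<Longrightarrow>
    t \<in> sections E \<Longrightarrow> \<eta> (Vs[i := sec_add E s t]) = (\<lambda>x. \<eta> (Vs[i := s]) x + \<eta> (Vs[i := t]) x)"
  and alternating_forms_mult:
  "\<eta> \<in> alternating_forms E p \<Longrightarrow> Vs \<in> section_tuples E p \<Longrightarrow> i < p \<Longrightarrow>
    f \<in> smooth_functions (base_charts E) \<Longrightarrow> s \<in> sections E \<Longrightarrow>
    \<eta> (Vs[i := sec_mult E f s]) = (\<lambda>x. f x * \<eta> (Vs[i := s]) x)"
  and alternating_forms_repeat:
  "\<eta> \<in> alternating_forms E p \<Longrightarrow> Vs \<in> section_tuples E p \<Longrightarrow> i < p \<Longrightarrow> j < p \<Longrightarrow> i \<noteq> j \<Longrightarrow>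
    Vs ! i = Vs ! j \<Longrightarrow> \<eta> Vs = (\<lambda>_. 0)"
  by (simp_all add: alternating_forms_def)

text \<open>Polarization: alternation is defined by vanishing on repeated arguments, so the value
  with \<open>sec_add E s t\<close> in both slots is zero; expanding it, the two pure terms vanish
  as well and the mixed terms remain.\<close>

lemma alternating_forms_swap:
  assumes E: "smooth_vector_bundle E" and \<eta>: "\<eta> \<in> alternating_forms E p"
    and Vs: "Vs \<in> section_tuples E p" and ij: "i < p" "j < p" "i \<noteq> j"
    and st: "s \<in> sections E" "t \<in> sections E"
  shows "\<eta> (Vs[i := s, j := t]) x + \<eta> (Vs[i := t, j := s]) x = 0"
proof -
  define W where "W a b = \<eta> (Vs[i := a, j := b])" for a b
  \<comment> \<open>The slots are distinct, so the order of the updates is free; the second order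
    exposes slot \<open>i\<close> for additivity.\<close>
  have W: "W a b = \<eta> (Vs[j := b, i := a])" for a b
    using ij(3) by (simp add: W_def list_update_swap)
  have repeat: "W a a x = 0" if "a \<in> sections E" for a
    using alternating_forms_repeat[OF \<eta> _ ij, of "Vs[i := a, j := a]"] Vs ij that
    by (simp add: W_def section_tuples_update section_tuples_length)
  have right: "W a (sec_add E s t) x = W a s x + W a t x" if "a \<in> sections E" for a
    using alternating_forms_add[OF \<eta> section_tuples_update[OF Vs that] ij(2) st]
    by (simp add: W_def)
  have left: "W (sec_add E s t) a x = W s a x + W t a x" if "a \<in> sections E" for a
    using alternating_forms_add[OF \<eta> section_tuples_update[OF Vs that] ij(1) st]
    by (simp add: W)
  have u: "sec_add E s t \<in> sections E" using sec_add_in_sections[OF E st] .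
  have "W (sec_add E s t) (sec_add E s t) x = W s s x + W s t x + (W t s x + W t t x)"
    using right left st u by simp
  then show ?thesis using repeat st u by (simp add: W_def)
qed

text \<open>The only tuple of length zero is the empty list, which voids the multilinearity and
  alternation clauses. Degree zero thereby joins the positive degrees, and only the sign of
  \<open>p\<close> has to be distinguished.\<close>

lemma alternating_forms_0:
  fixes E :: "('m, 'c::real_normed_vector, 'e, 'f::real_normed_vector, 'z) vector_bundle_scheme"
  shows "alternating_forms E 0 = function_form ` smooth_functions (base_charts E)"
proof -
  have "section_tuples E 0 = {[]}" by (auto simp: section_tuples_def)
  then have *: "alternating_forms E 0 =
      {\<eta>. \<eta> [] \<in> smooth_functions (base_charts E) \<and> (\<forall>Vs. Vs \<noteq> [] \<longrightarrow> \<eta> Vs = (\<lambda>_. 0))}"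
    by (auto simp: alternating_forms_def)
  show ?thesis
    unfolding *
  proof (intro set_eqI iffI)
    fix \<eta> :: "('m, 'e) form"
    assume "\<eta> \<in> {\<eta>. \<eta> [] \<in> smooth_functions (base_charts E) \<and> (\<forall>Vs. Vs \<noteq> [] \<longrightarrow> \<eta> Vs = (\<lambda>_. 0))}"
    then show "\<eta> \<in> function_form ` smooth_functions (base_charts E)"
      by (intro image_eqI[of _ _ "\<eta> []"]) (auto simp: function_form_def)
  qed (auto simp: function_form_def)
qed

lemma forms_eq: "forms E p = (if p < 0 then {zero_form} else alternating_forms E (nat p))"
  by (simp add: forms_def alternating_forms_0)

section \<open>The graded vector space of forms\<close>

lemma zero_form_in_forms:
  assumes "smooth_manifold (base_charts E)"
  shows "zero_form \<in> forms E p"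
  using smooth_functions_const[OF assms]
  by (simp add: forms_eq alternating_forms_def zero_form_def)

lemma forms_add:
  assumes "smooth_manifold (base_charts E)" "\<eta> \<in> forms E p" "\<zeta> \<in> forms E p"
  shows "(\<lambda>Vs x. \<eta> Vs x + \<zeta> Vs x) \<in> forms E p"
  using assms(2,3) smooth_functions_add[OF assms(1)]
  by (auto simp: forms_eq zero_form_def alternating_forms_def distrib_left split: if_splits)

lemma forms_scale:
  assumes "smooth_manifold (base_charts E)" "\<eta> \<in> forms E p"
  shows "(\<lambda>Vs x. a * \<eta> Vs x) \<in> forms E p"
  using assms(2) smooth_functions_mult[OF assms(1) smooth_functions_const[OF assms(1)]]
  by (auto simp: forms_eq zero_form_def alternating_forms_def distrib_left split: if_splits)

lemma homogeneous_in_Omega: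
  assumes "smooth_manifold (base_charts E)" "\<eta> \<in> forms E p"
  shows "homogeneous p \<eta> \<in> Omega E"
proof -
  have "{q. homogeneous p \<eta> q \<noteq> zero_form} \<subseteq> {p}" by (auto simp: homogeneous_def)
  then show ?thesis
    using assms zero_form_in_forms finite_subset by (auto simp: Omega_def homogeneous_def)
qed

lemma Omega_add:
  assumes "smooth_manifold (base_charts E)" "\<omega> \<in> Omega E" "\<omega>' \<in> Omega E"
  shows "(\<lambda>p Vs x. \<omega> p Vs x + \<omega>' p Vs x) \<in> Omega E"
proof -
  have "{p. (\<lambda>Vs x. \<omega> p Vs x + \<omega>' p Vs x) \<noteq> zero_form} \<subseteq>
      {p. \<omega> p \<noteq> zero_form} \<union> {p. \<omega>' p \<noteq> zero_form}"
    by (auto simp: zero_form_def)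
  then show ?thesis
    using assms(2,3) forms_add[OF assms(1)] by (auto simp: Omega_def intro: finite_subset)
qed

lemma Omega_scale:
  assumes "smooth_manifold (base_charts E)" "\<omega> \<in> Omega E"
  shows "(\<lambda>p Vs x. a * \<omega> p Vs x) \<in> Omega E"
proof -
  have "{p. (\<lambda>Vs x. a * \<omega> p Vs x) \<noteq> zero_form} \<subseteq> {p. \<omega> p \<noteq> zero_form}"
    by (auto simp: zero_form_def)
  then show ?thesis
    using assms(2) forms_scale[OF assms(1)] by (auto simp: Omega_def intro: finite_subset)
qed

text \<open>Finite support permits splitting off one homogeneous component at a time. The induction
  runs over a finite set that merely contains the support, so it makes no difference whether the
  removed component is zero.\<close>

lemma graded_endomorphism_eqI:
  assumes A: "smooth_manifold (base_charts E)"
    and L: "graded_endomorphism_degree_0 E L" and L': "graded_endomorphism_degree_0 E L'"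
    and eq: "\<And>p \<eta>. \<eta> \<in> forms E p \<Longrightarrow> L (homogeneous p \<eta>) = L' (homogeneous p \<eta>)"
    and "\<omega> \<in> Omega E"
  shows "L \<omega> = L' \<omega>"
proof -
  have "L \<omega> = L' \<omega>" if "finite S" "\<omega> \<in> Omega E" "{p. \<omega> p \<noteq> zero_form} \<subseteq> S" for S \<omega>
    using that
  proof (induction S arbitrary: \<omega>)
    case empty
    \<comment> \<open>Written as \<open>0\<close> times itself, the zero family is sent to zero by
      compatibility with scalars.\<close>
    then have "\<omega> = (\<lambda>p Vs x. 0 * \<omega> p Vs x)" by (auto simp: zero_form_def fun_eq_iff)
    moreover have "L (\<lambda>p Vs x. 0 * \<omega> p Vs x) = (\<lambda>p Vs x. 0 * L \<omega> p Vs x)"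
      "L' (\<lambda>p Vs x. 0 * \<omega> p Vs x) = (\<lambda>p Vs x. 0 * L' \<omega> p Vs x)"
      using L L' empty.prems(1) unfolding graded_endomorphism_degree_0_def by blast+
    ultimately show ?case by simp
  next
    case (insert p S)
    define \<omega>1 where "\<omega>1 = homogeneous p (\<omega> p)"
    define \<omega>2 where "\<omega>2 = (\<lambda>q. if q = p then zero_form else \<omega> q)"
    have p: "\<omega> p \<in> forms E p" using insert.prems(1) by (simp add: Omega_def)
    have \<omega>1: "\<omega>1 \<in> Omega E" "L \<omega>1 = L' \<omega>1"
      using homogeneous_in_Omega[OF A p] eq[OF p] by (simp_all add: \<omega>1_def)
    have "{q. \<omega>2 q \<noteq> zero_form} \<subseteq> {q. \<omega> q \<noteq> zero_form}" by (auto simp: \<omega>2_def)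
    then have "finite {q. \<omega>2 q \<noteq> zero_form}"
      by (rule finite_subset) (use insert.prems(1) in \<open>simp add: Omega_def\<close>)
    then have \<omega>2: "\<omega>2 \<in> Omega E"
      using insert.prems(1) zero_form_in_forms[OF A] by (simp add: Omega_def \<omega>2_def)
    have "{q. \<omega>2 q \<noteq> zero_form} \<subseteq> S" using insert.prems(2) by (auto simp: \<omega>2_def)
    with \<omega>2 have "L \<omega>2 = L' \<omega>2" by (rule insert.IH)
    moreover have "\<omega> = (\<lambda>q Vs x. \<omega>1 q Vs x + \<omega>2 q Vs x)"
      by (auto simp: \<omega>1_def \<omega>2_def homogeneous_def zero_form_def fun_eq_iff)
    moreover have "L (\<lambda>q Vs x. \<omega>1 q Vs x + \<omega>2 q Vs x) = (\<lambda>q Vs x. L \<omega>1 q Vs x + L \<omega>2 q Vs x)"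
      "L' (\<lambda>q Vs x. \<omega>1 q Vs x + \<omega>2 q Vs x) = (\<lambda>q Vs x. L' \<omega>1 q Vs x + L' \<omega>2 q Vs x)"
      using L L' \<omega>1(1) \<omega>2 unfolding graded_endomorphism_degree_0_def by blast+
    ultimately show ?case using \<omega>1(2) by simp
  qed
  then show ?thesis using assms(5) by (auto simp: Omega_def)
qed


section \<open>The Lie derivative of forms\<close>

locale lie_algebroid_section =
  fixes E :: "('m::{t2_space,second_countable_topology}, 'c::real_normed_vector, 'e,
      'f::real_normed_vector) lie_algebroid"
    and V :: "'m \<Rightarrow> 'e"
  assumes algebroid: "is_lie_algebroid E" and V: "V \<in> sections E"
begin

section \<open>Differentiation and bracket along the fixed section\<close>

lemma smooth_bundle: "smooth_vector_bundle E"
  using algebroid by (simp add: is_lie_algebroid_def)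

lemma base_manifold: "smooth_manifold (base_charts E)"
  by (rule smooth_vector_bundle_base[OF smooth_bundle])

lemma anchor_map: "bundle_map_to_tangent E (anchor E)"
  using algebroid by (simp add: is_lie_algebroid_def)

lemma anchor_V: "anchor E (V x) \<in> tangent_bundle (base_charts E)" "fst (anchor E (V x)) = x"
  using anchor_map section_fibre[OF V, of x] by (simp_all add: bundle_map_to_tangent_def fibre_def)

text \<open>This is the \<open>D\<close> of the overview, taken through the differential, for which
  the sum and product rules are available; on smooth functions it agrees with
  \<open>lie_derivative\<close>.\<close>

definition deriv_along :: "('m \<Rightarrow> real) \<Rightarrow> 'm \<Rightarrow> real" where
  "deriv_along f = (\<lambda>x. differential (base_charts E) f (anchor E (V x)))"

lemma contraction_differential:
  "contraction (anchor E \<circ> V) (differential (base_charts E) f) = deriv_along f"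
  by (simp add: contraction_def deriv_along_def)

lemma lie_derivative_eq_deriv_along:
  "f \<in> smooth_functions (base_charts E) \<Longrightarrow>
    lie_derivative (base_charts E) (anchor E \<circ> V) f = deriv_along f"
  by (simp add: fun_eq_iff deriv_along_def anchor_V lie_derivative_eq_differential[OF base_manifold])

lemma deriv_along_smooth:
  "f \<in> smooth_functions (base_charts E) \<Longrightarrow> deriv_along f \<in> smooth_functions (base_charts E)"
  unfolding deriv_along_def
  using smooth_tangent_image_of_section[OF smooth_bundle anchor_map V]
  by (intro smooth_differential_along[OF base_manifold] anchor_V) simp_all

lemma deriv_along_const: "deriv_along (\<lambda>_. a) = (\<lambda>_. 0)"
  by (simp add: deriv_along_def differential_const)

lemma deriv_along_add:
  "f \<in> smooth_functions (base_charts E) \<Longrightarrow> g \<in> smooth_functions (base_charts E) \<Longrightarrow>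
    deriv_along (\<lambda>x. f x + g x) = (\<lambda>x. deriv_along f x + deriv_along g x)"
  by (simp add: deriv_along_def differential_add[OF base_manifold])

lemma deriv_along_mult:
  "f \<in> smooth_functions (base_charts E) \<Longrightarrow> g \<in> smooth_functions (base_charts E) \<Longrightarrow>
    deriv_along (\<lambda>x. f x * g x) = (\<lambda>x. f x * deriv_along g x + deriv_along f x * g x)"
  by (simp add: deriv_along_def differential_mult[OF base_manifold] anchor_V)

lemma deriv_along_scale:
  "f \<in> smooth_functions (base_charts E) \<Longrightarrow> deriv_along (\<lambda>x. a * f x) = (\<lambda>x. a * deriv_along f x)"
  using deriv_along_mult[OF smooth_functions_const[OF base_manifold, of a]] by (simp add: deriv_along_const)

lemma bracket_section: "s \<in> sections E \<Longrightarrow> bracket E V s \<in> sections E"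
  using algebroid V by (simp add: is_lie_algebroid_def lie_bracket_on_sections_def)

lemma bracket_add:
  "s \<in> sections E \<Longrightarrow> t \<in> sections E \<Longrightarrow>
    bracket E V (sec_add E s t) = sec_add E (bracket E V s) (bracket E V t)"
  using algebroid V by (simp add: is_lie_algebroid_def lie_bracket_on_sections_def)

lemma bracket_mult:
  "f \<in> smooth_functions (base_charts E) \<Longrightarrow> s \<in> sections E \<Longrightarrow>
    bracket E V (sec_mult E f s) = sec_add E (sec_mult E f (bracket E V s)) (sec_mult E (deriv_along f) s)"
  using algebroid V by (simp add: is_lie_algebroid_def flip: lie_derivative_eq_deriv_along)

section \<open>The right-hand side of (ii) as an alternating form\<close>

definition bracket_in_slot :: "nat \<Rightarrow> ('m \<Rightarrow> 'e) list \<Rightarrow> ('m \<Rightarrow> 'e) list" where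
  "bracket_in_slot k Vs = Vs[k := bracket E V (Vs ! k)]"

text \<open>Using \<open>deriv_along\<close> for the operator on functions removes the
  self-reference in (ii). The value \<open>0\<close> off the tuples matches the normalization built
  into \<open>alternating_forms\<close>.\<close>

definition lie_form :: "nat \<Rightarrow> ('m, 'e) form \<Rightarrow> ('m, 'e) form" where
  "lie_form p \<eta> = (\<lambda>Vs. if Vs \<in> section_tuples E p
     then (\<lambda>x. deriv_along (\<eta> Vs) x - (\<Sum>k<p. \<eta> (bracket_in_slot k Vs) x)) else (\<lambda>_. 0))"

lemma bracket_in_slot_tuple:
  "Vs \<in> section_tuples E p \<Longrightarrow> k < p \<Longrightarrow> bracket_in_slot k Vs \<in> section_tuples E p"
  by (simp add: bracket_in_slot_def section_tuples_update bracket_section section_tuples_nth)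

lemma bracket_in_slot_update_same:
  "Vs \<in> section_tuples E p \<Longrightarrow> k < p \<Longrightarrow> bracket_in_slot k (Vs[k := s]) = Vs[k := bracket E V s]"
  by (simp add: bracket_in_slot_def section_tuples_length)

lemma bracket_in_slot_update_other:
  "k \<noteq> i \<Longrightarrow> bracket_in_slot k (Vs[i := s]) = (bracket_in_slot k Vs)[i := s]"
  by (simp add: bracket_in_slot_def list_update_swap)

text \<open>Additivity has two sources: that of the bracket when the bracket acts in the slot of the
  sum, and that of \<open>\<eta>\<close> on the modified tuple otherwise.\<close>

lemma form_bracket_in_slot_add:
  assumes \<eta>: "\<eta> \<in> alternating_forms E p" and Vs: "Vs \<in> section_tuples E p" and ik: "i < p" "k < p"
    and st: "s \<in> sections E" "t \<in> sections E"
  shows "\<eta> (bracket_in_slot k (Vs[i := sec_add E s t])) x =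
    \<eta> (bracket_in_slot k (Vs[i := s])) x + \<eta> (bracket_in_slot k (Vs[i := t])) x"
proof (cases "k = i")
  case True
  then show ?thesis
    using alternating_forms_add[OF \<eta> Vs ik(1) st[THEN bracket_section]]
    by (simp add: bracket_in_slot_update_same[OF Vs ik(1)] bracket_add st)
next
  case False
  then show ?thesis
    using alternating_forms_add[OF \<eta> bracket_in_slot_tuple[OF Vs ik(2)] ik(1) st]
    by (simp add: bracket_in_slot_update_other)
qed

text \<open>The Leibniz correction appears only when the bracket meets the slot that carries
  \<open>f\<close>. The conditional records this, so that summation over \<open>k\<close> yields the
  correction exactly once.\<close>

lemma form_bracket_in_slot_mult:
  assumes \<eta>: "\<eta> \<in> alternating_forms E p" and Vs: "Vs \<in> section_tuples E p" and ik: "i < p" "k < p"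
    and f: "f \<in> smooth_functions (base_charts E)" and s: "s \<in> sections E"
  shows "\<eta> (bracket_in_slot k (Vs[i := sec_mult E f s])) x =
    f x * \<eta> (bracket_in_slot k (Vs[i := s])) x + (if k = i then deriv_along f x * \<eta> (Vs[i := s]) x else 0)"
proof (cases "k = i")
  case True
  have "sec_mult E f (bracket E V s) \<in> sections E" "sec_mult E (deriv_along f) s \<in> sections E"
    using f s by (simp_all add: sec_mult_in_sections[OF smooth_bundle] bracket_section deriv_along_smooth)
  from alternating_forms_add[OF \<eta> Vs ik(1) this]
  show ?thesis
    using True alternating_forms_mult[OF \<eta> Vs ik(1) f bracket_section[OF s]]
      alternating_forms_mult[OF \<eta> Vs ik(1) deriv_along_smooth[OF f] s]
    by (simp add: bracket_in_slot_update_same[OF Vs ik(1)] bracket_mult[OF f s])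
next
  case False
  then show ?thesis
    using alternating_forms_mult[OF \<eta> bracket_in_slot_tuple[OF Vs ik(2)] ik(1) f s]
    by (simp add: bracket_in_slot_update_other)
qed

lemma sum_bracket_in_slot_repeat:
  assumes \<eta>: "\<eta> \<in> alternating_forms E p" and Vs: "Vs \<in> section_tuples E p"
    and ij: "i < p" "j < p" "i \<noteq> j" and eq: "Vs ! i = Vs ! j"
  shows "(\<Sum>k<p. \<eta> (bracket_in_slot k Vs) x) = 0"
proof -
  have "\<eta> (bracket_in_slot k Vs) x = 0" if "k < p" "k \<noteq> i" "k \<noteq> j" for k
    using alternating_forms_repeat[OF \<eta> bracket_in_slot_tuple[OF Vs that(1)] ij] eq that
    by (simp add: bracket_in_slot_def)
  then have "(\<Sum>k<p. \<eta> (bracket_in_slot k Vs) x) = (\<Sum>k\<in>{i, j}. \<eta> (bracket_in_slot k Vs) x)"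
    using ij by (intro sum.mono_neutral_right) auto
  also have "\<dots> = \<eta> (bracket_in_slot i Vs) x + \<eta> (bracket_in_slot j Vs) x"
    using ij(3) by simp
  also have "\<dots> = 0"
  proof -
    define v where "v = Vs ! i"
    have v: "v \<in> sections E" using section_tuples_nth[OF Vs ij(1)] v_def by simp
    \<comment> \<open>Slot \<open>j\<close> already holds \<open>v\<close>, so the extra update
      changes nothing; it displays the two tuples as the two orders of one pair of entries, ready
      for \<open>alternating_forms_swap\<close>.\<close>
    have "bracket_in_slot i Vs = Vs[i := bracket E V v, j := v]"
      using eq ij(3) by (simp add: bracket_in_slot_def v_def list_update_swap[of i j])
    moreover have "bracket_in_slot j Vs = Vs[i := v, j := bracket E V v]"
      unfolding v_def list_update_id by (simp add: bracket_in_slot_def eq)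
    ultimately show ?thesis
      using alternating_forms_swap[OF smooth_bundle \<eta> Vs ij bracket_section[OF v] v] by simp
  qed
  finally show ?thesis .
qed

lemma lie_form_alternating:
  assumes \<eta>: "\<eta> \<in> alternating_forms E p"
  shows "lie_form p \<eta> \<in> alternating_forms E p"
proof -
  note smooth = alternating_forms_smooth[OF \<eta>]
  have "lie_form p \<eta> Vs \<in> smooth_functions (base_charts E)" if Vs: "Vs \<in> section_tuples E p" for Vs
    using that
    by (auto simp: lie_form_def intro!: smooth_functions_diff[OF base_manifold] smooth_functions_sum[OF base_manifold]
        deriv_along_smooth smooth bracket_in_slot_tuple)
  moreover have "lie_form p \<eta> (Vs[i := sec_add E s t]) x =
      lie_form p \<eta> (Vs[i := s]) x + lie_form p \<eta> (Vs[i := t]) x"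
    if Vs: "Vs \<in> section_tuples E p" and i: "i < p" and st: "s \<in> sections E" "t \<in> sections E"
    for Vs i s t x
  proof -
    have tup: "Vs[i := s] \<in> section_tuples E p" "Vs[i := t] \<in> section_tuples E p"
      "Vs[i := sec_add E s t] \<in> section_tuples E p"
      using Vs st sec_add_in_sections[OF smooth_bundle st] by (simp_all add: section_tuples_update)
    have "(\<Sum>k<p. \<eta> (bracket_in_slot k (Vs[i := sec_add E s t])) x) =
        (\<Sum>k<p. \<eta> (bracket_in_slot k (Vs[i := s])) x) + (\<Sum>k<p. \<eta> (bracket_in_slot k (Vs[i := t])) x)"
      using form_bracket_in_slot_add[OF \<eta> Vs i _ st] by (simp add: sum.distrib)
    then show ?thesis
      using tup by (simp add: lie_form_def alternating_forms_add[OF \<eta> Vs i st] deriv_along_add smooth)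
  qed
  moreover have "lie_form p \<eta> (Vs[i := sec_mult E f s]) x = f x * lie_form p \<eta> (Vs[i := s]) x"
    if Vs: "Vs \<in> section_tuples E p" and i: "i < p" and f: "f \<in> smooth_functions (base_charts E)"
      and s: "s \<in> sections E" for Vs i f s x
  proof -
    have tup: "Vs[i := s] \<in> section_tuples E p" "Vs[i := sec_mult E f s] \<in> section_tuples E p"
      using Vs s sec_mult_in_sections[OF smooth_bundle f s] by (simp_all add: section_tuples_update)
    have "(\<Sum>k<p. \<eta> (bracket_in_slot k (Vs[i := sec_mult E f s])) x) =
        f x * (\<Sum>k<p. \<eta> (bracket_in_slot k (Vs[i := s])) x) + deriv_along f x * \<eta> (Vs[i := s]) x"
      using form_bracket_in_slot_mult[OF \<eta> Vs i _ f s] i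
      by (simp add: sum.distrib sum_distrib_left)
    then show ?thesis
      using tup by (simp add: lie_form_def alternating_forms_mult[OF \<eta> Vs i f s]
          deriv_along_mult f smooth right_diff_distrib)
  qed
  moreover have "lie_form p \<eta> Vs = (\<lambda>_. 0)"
    if "Vs \<in> section_tuples E p" "i < p" "j < p" "i \<noteq> j" "Vs ! i = Vs ! j" for Vs i j
    using that alternating_forms_repeat[OF \<eta> that] sum_bracket_in_slot_repeat[OF \<eta> that]
    by (simp add: lie_form_def deriv_along_const)
  moreover have "lie_form p \<eta> Vs = (\<lambda>_. 0)" if "Vs \<notin> section_tuples E p" for Vs
    using that by (simp add: lie_form_def)
  ultimately show ?thesis
    unfolding alternating_forms_def by (simp add: fun_eq_iff)
qed

text \<open>Applied degree by degree, this keeps supports from growing and homogeneous elements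
  homogeneous.\<close>

lemma lie_form_zero: "lie_form p zero_form = zero_form"
  by (simp add: lie_form_def zero_form_def deriv_along_const fun_eq_iff)

lemma lie_form_add:
  assumes "\<eta> \<in> alternating_forms E p" "\<zeta> \<in> alternating_forms E p"
  shows "lie_form p (\<lambda>Vs x. \<eta> Vs x + \<zeta> Vs x) = (\<lambda>Vs x. lie_form p \<eta> Vs x + lie_form p \<zeta> Vs x)"
  using assms[THEN alternating_forms_smooth]
  by (simp add: lie_form_def fun_eq_iff deriv_along_add sum.distrib)

lemma lie_form_scale:
  assumes "\<eta> \<in> alternating_forms E p"
  shows "lie_form p (\<lambda>Vs x. a * \<eta> Vs x) = (\<lambda>Vs x. a * lie_form p \<eta> Vs x)"
  using alternating_forms_smooth[OF assms]
  by (simp add: lie_form_def fun_eq_iff deriv_along_scale right_diff_distrib sum_distrib_left)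

lemma lie_form_function: "lie_form 0 (function_form f) = function_form (deriv_along f)"
  by (auto simp: lie_form_def function_form_def section_tuples_def fun_eq_iff)

text \<open>The restriction to \<open>Omega E\<close> gives the fixed value elsewhere that
  \<open>extensional\<close> demands. The guard keeps negative degrees, which \<open>nat\<close>
  sends to \<open>0\<close>, apart from functions.\<close>

definition lie_graded :: "('m, 'e) graded_form \<Rightarrow> ('m, 'e) graded_form" where
  "lie_graded = (\<lambda>\<omega>\<in>Omega E. \<lambda>p. if p < 0 then zero_form else lie_form (nat p) (\<omega> p))"

lemma lie_graded_homogeneous:
  assumes "\<eta> \<in> forms E p"
  shows "lie_graded (homogeneous p \<eta>) =
    homogeneous p (if p < 0 then zero_form else lie_form (nat p) \<eta>)"
  using homogeneous_in_Omega[OF base_manifold assms]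
  by (auto simp: lie_graded_def homogeneous_def lie_form_zero fun_eq_iff)

lemma lie_form_forms: "p \<ge> 0 \<Longrightarrow> \<eta> \<in> forms E p \<Longrightarrow> lie_form (nat p) \<eta> \<in> forms E p"
  by (simp add: forms_eq lie_form_alternating)

lemma lie_graded_endomorphism: "graded_endomorphism_degree_0 E lie_graded"
  unfolding graded_endomorphism_degree_0_def
proof (intro conjI ballI allI)
  have form: "\<omega> p \<in> forms E p" if "\<omega> \<in> Omega E" for \<omega> p using that by (simp add: Omega_def)
  have alt: "\<omega> p \<in> alternating_forms E (nat p)" if "\<omega> \<in> Omega E" "\<not> p < 0" for \<omega> p
    using form[OF that(1), of p] that(2) by (simp add: forms_eq)
  show "lie_graded \<omega> \<in> Omega E" if "\<omega> \<in> Omega E" for \<omega>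
  proof -
    have "{p. lie_graded \<omega> p \<noteq> zero_form} \<subseteq> {p. \<omega> p \<noteq> zero_form}"
      using that by (auto simp: lie_graded_def lie_form_zero)
    moreover have "finite {p. \<omega> p \<noteq> zero_form}" using that by (simp add: Omega_def)
    ultimately have "finite {p. lie_graded \<omega> p \<noteq> zero_form}" by (rule finite_subset)
    moreover have "lie_graded \<omega> p \<in> forms E p" for p
      using that lie_form_forms[OF _ form[OF that, of p]] zero_form_in_forms[OF base_manifold]
      by (simp add: lie_graded_def)
    ultimately show ?thesis by (simp add: Omega_def)
  qed
  show "lie_graded (\<lambda>p Vs x. \<omega> p Vs x + \<omega>' p Vs x) = (\<lambda>p Vs x. lie_graded \<omega> p Vs x + lie_graded \<omega>' p Vs x)"
    if "\<omega> \<in> Omega E" "\<omega>' \<in> Omega E" for \<omega> \<omega>'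
  proof
    show "lie_graded (\<lambda>p Vs x. \<omega> p Vs x + \<omega>' p Vs x) p =
        (\<lambda>Vs x. lie_graded \<omega> p Vs x + lie_graded \<omega>' p Vs x)" for p
      using that Omega_add[OF base_manifold that] lie_form_add[OF that[THEN alt, of p]]
      by (simp add: lie_graded_def zero_form_def)
  qed
  show "lie_graded (\<lambda>p Vs x. a * \<omega> p Vs x) = (\<lambda>p Vs x. a * lie_graded \<omega> p Vs x)"
    if "\<omega> \<in> Omega E" for a \<omega>
  proof
    show "lie_graded (\<lambda>p Vs x. a * \<omega> p Vs x) p = (\<lambda>Vs x. a * lie_graded \<omega> p Vs x)" for p
      using that Omega_scale[OF base_manifold that] lie_form_scale[OF alt[OF that, of p]]
      by (simp add: lie_graded_def zero_form_def)
  qed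
  show "lie_graded (homogeneous p \<eta>) \<in> homogeneous p ` forms E p" if "\<eta> \<in> forms E p" for p \<eta>
    unfolding lie_graded_homogeneous[OF that]
    using that zero_form_in_forms[OF base_manifold] lie_form_forms by auto
qed

lemma function_form_in_forms: "f \<in> smooth_functions (base_charts E) \<Longrightarrow> function_form f \<in> forms E 0"
  by (simp add: forms_def)

lemma lie_graded_function:
  assumes "f \<in> smooth_functions (base_charts E)"
  shows "lie_graded (homogeneous 0 (function_form f)) = homogeneous 0 (function_form (deriv_along f))"
  using lie_graded_homogeneous[OF function_form_in_forms[OF assms]] by (simp add: lie_form_function)

text \<open>Condition (ii) controls only the component of degree \<open>p\<close>, and only on
  tuples of sections. Preservation of degree settles the rest: the image is
  \<open>homogeneous p \<zeta>\<close> with \<open>\<zeta>\<close> a form, so its other components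
  are zero and \<open>\<zeta>\<close> vanishes off the tuples. In negative degrees the only form is
  zero.\<close>

lemma lie_graded_unique:
  assumes L: "graded_endomorphism_degree_0 E L"
    and func: "\<And>f. f \<in> smooth_functions (base_charts E) \<Longrightarrow>
      L (homogeneous 0 (function_form f)) = homogeneous 0 (function_form (deriv_along f))"
    and pos: "\<And>p \<eta> Vs. p > 0 \<Longrightarrow> \<eta> \<in> forms E p \<Longrightarrow> Vs \<in> section_tuples E (nat p) \<Longrightarrow>
      L (homogeneous p \<eta>) p Vs = lie_form (nat p) \<eta> Vs"
    and \<omega>: "\<omega> \<in> Omega E"
  shows "L \<omega> = lie_graded \<omega>"
proof (rule graded_endomorphism_eqI[OF base_manifold L lie_graded_endomorphism _ \<omega>])
  fix p and \<eta> :: "('m, 'e) form" assume \<eta>: "\<eta> \<in> forms E p"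
  obtain \<zeta> where \<zeta>: "\<zeta> \<in> forms E p" "L (homogeneous p \<eta>) = homogeneous p \<zeta>"
    using L \<eta> unfolding graded_endomorphism_degree_0_def by blast
  consider "p < 0" | "p = 0" | "p > 0" by linarith
  then show "L (homogeneous p \<eta>) = lie_graded (homogeneous p \<eta>)"
  proof cases
    case 1
    then show ?thesis using \<zeta> lie_graded_homogeneous[OF \<eta>] by (simp add: forms_eq)
  next
    case 2
    then obtain f where "f \<in> smooth_functions (base_charts E)" "\<eta> = function_form f"
      using \<eta> by (auto simp: forms_def)
    then show ?thesis using 2 func lie_graded_function by simp
  next
    case 3
    have "\<zeta> Vs = lie_form (nat p) \<eta> Vs" for Vs
    proof (cases "Vs \<in> section_tuples E (nat p)")
      case True
      then show ?thesis using pos[OF 3 \<eta>] \<zeta>(2) by (simp add: homogeneous_def)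
    next
      case False
      then show ?thesis
        using \<zeta>(1) 3 alternating_forms_off by (auto simp: forms_eq lie_form_def)
    qed
    then have "\<zeta> = lie_form (nat p) \<eta>" by blast
    then show ?thesis using \<zeta>(2) lie_graded_homogeneous[OF \<eta>] 3 by simp
  qed
qed

end

theorem proposition5p1p1:
  fixes E :: "('m::{t2_space,second_countable_topology}, 'c::real_normed_vector, 'e,
                'f::real_normed_vector) lie_algebroid"
    and V :: "'m \<Rightarrow> 'e"
  assumes "is_lie_algebroid E"
    and "V \<in> sections E"
  shows "\<exists>!L :: ('m, 'e) graded_form \<Rightarrow> ('m, 'e) graded_form.
    L \<in> extensional (Omega E) \<and>
    graded_endomorphism_degree_0 E L \<and>
    (\<forall>f\<in>smooth_functions (base_charts E).
       L (homogeneous 0 (function_form f)) =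
         homogeneous 0 (function_form
           (contraction (anchor E \<circ> V) (differential (base_charts E) f))) \<and>
       contraction (anchor E \<circ> V) (differential (base_charts E) f) =
         lie_derivative (base_charts E) (anchor E \<circ> V) f) \<and>
    (\<forall>p>0. \<forall>\<eta>\<in>forms E p. \<forall>Vs\<in>section_tuples E (nat p).
       L (homogeneous p \<eta>) p Vs =
         (\<lambda>x. L (homogeneous 0 (function_form (\<eta> Vs))) 0 [] x
            - (\<Sum>i<nat p. \<eta> (Vs[i := bracket E V (Vs ! i)]) x)))"
proof -
  interpret lie_algebroid_section E V
    using assms by unfold_locales
  have smooth: "\<eta> Vs \<in> smooth_functions (base_charts E)"
    if "p > 0" "\<eta> \<in> forms E p" "Vs \<in> section_tuples E (nat p)" for p \<eta> Vs
    using that alternating_forms_smooth by (auto simp: forms_eq)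
  \<comment> \<open>For any \<open>L\<close> satisfying (i), the term in (ii) that involves
    \<open>L\<close> on functions is \<open>deriv_along\<close>; evaluation at degree
    \<open>0\<close> and \<open>[]\<close> reads the function back from its form. Leaving
    \<open>L\<close> arbitrary lets the identity serve both existence, with
    \<open>lie_graded\<close>, and uniqueness.\<close>
  have formula: "lie_form (nat p) \<eta> Vs =
      (\<lambda>x. L (homogeneous 0 (function_form (\<eta> Vs))) 0 [] x
        - (\<Sum>i<nat p. \<eta> (Vs[i := bracket E V (Vs ! i)]) x))"
    if "p > 0" "\<eta> \<in> forms E p" "Vs \<in> section_tuples E (nat p)"
      and func: "\<And>f. f \<in> smooth_functions (base_charts E) \<Longrightarrow>
        L (homogeneous 0 (function_form f)) = homogeneous 0 (function_form (deriv_along f))"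
    for L :: "('m, 'e) graded_form \<Rightarrow> ('m, 'e) graded_form" and p \<eta> Vs
    using that(3) func[OF smooth[OF that(1-3)]]
    by (simp add: lie_form_def bracket_in_slot_def homogeneous_def function_form_def)
  show ?thesis
  proof (rule ex1I[of _ lie_graded], goal_cases)
    case 1
    have "lie_graded \<in> extensional (Omega E)" by (simp add: lie_graded_def)
    moreover have "lie_graded (homogeneous p \<eta>) p Vs = lie_form (nat p) \<eta> Vs"
      if "p > 0" "\<eta> \<in> forms E p" for p \<eta> Vs
      using lie_graded_homogeneous[OF that(2)] that(1) by (simp add: homogeneous_def)
    ultimately show ?case
      using lie_graded_endomorphism lie_graded_function formula[OF _ _ _ lie_graded_function]
      by (simp add: contraction_differential lie_derivative_eq_deriv_along)
  next
    case (2 L)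
    then have L: "L \<in> extensional (Omega E)" "graded_endomorphism_degree_0 E L"
      and func: "\<And>f. f \<in> smooth_functions (base_charts E) \<Longrightarrow>
        L (homogeneous 0 (function_form f)) = homogeneous 0 (function_form (deriv_along f))"
      and pos: "\<And>p \<eta> Vs. p > 0 \<Longrightarrow> \<eta> \<in> forms E p \<Longrightarrow> Vs \<in> section_tuples E (nat p) \<Longrightarrow>
        L (homogeneous p \<eta>) p Vs = (\<lambda>x. L (homogeneous 0 (function_form (\<eta> Vs))) 0 [] x
            - (\<Sum>i<nat p. \<eta> (Vs[i := bracket E V (Vs ! i)]) x))"
      unfolding contraction_differential by blast+
    have "L \<omega> = lie_graded \<omega>" if "\<omega> \<in> Omega E" for \<omega>
      by (rule lie_graded_unique[OF L(2) func _ that]) (simp_all add: pos formula[OF _ _ _ func])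
    moreover have "lie_graded \<in> extensional (Omega E)" by (simp add: lie_graded_def)
    ultimately show ?case using extensionalityI[OF L(1)] by blast
  qed
qed

end
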